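(* Let $k$ be a positive integer with $k\equiv 0 \pmod 4$, and let $f(z) = 1 + \sum_{n=1}^{\infty} a(n) q^{n} \in M_{k}$ satisfy $a(n) \geq 0$ for all integers $1 \leq n \leq k^{2} (\log k + \log \log k)^{2}$. Then $a(n) > 0$ for all integers $n \geq \frac{1}{7316} k^{4} (\log k + \log \log k)^{2}$.
   Context: $M_k$ is the space of holomorphic modular forms of weight $k$ for $\mathrm{SL}_2(\mathbb{Z})$, with Fourier expansion in $q=e^{2\pi i z}$. *)

theory Defs
  imports "HOL-Complex_Analysis.Complex_Analysis"
begin

definition upper_half_plane :: "complex set" where
  "upper_half_plane = {z. Im z > 0}"

definition qpar :: "complex \<Rightarrow> complex" where
  "qpar z = exp (2 * pi * \<i> * z)"

text \<open>Holomorphic modular form of weight k for SL2(Z): holomorphic on the upper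
half plane, invariant under the generators T and S of SL2(Z) with the weight-k
slash action, and bounded as Im z tends to infinity (holomorphic at the cusp).\<close>
definition modular_form :: "nat \<Rightarrow> (complex \<Rightarrow> complex) \<Rightarrow> bool" where
  "modular_form k f \<longleftrightarrow>
     f holomorphic_on upper_half_plane \<and>
     (\<forall>z\<in>upper_half_plane. f (z + 1) = f z) \<and>
     (\<forall>z\<in>upper_half_plane. f (- 1 / z) = z ^ k * f z) \<and>
     (\<exists>B. \<forall>z. Im z \<ge> 1 \<longrightarrow> norm (f z) \<le> B)"

definition fourier_coeffs :: "(complex \<Rightarrow> complex) \<Rightarrow> (nat \<Rightarrow> complex) \<Rightarrow> bool" where
  "fourier_coeffs f a \<longleftrightarrow> (\<forall>z\<in>upper_half_plane. (\<lambda>n. a n * qpar z ^ n) sums f z)"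

end

theory Submission
  imports Defs
begin

text \<open>
Write k = 2w and f = E + g, where E is the Eisenstein series and g a cusp form with coefficients c(n).
Hecke's argument gives c(n) = O(A n^w), where A is the sum of the |c(n)| exp(-2 pi n y0) with y0 = 4/5, a height
to which every orbit rises; this is to be compared with the coefficients of E, which grow like n^(k-1).
The point is to bound A. The form h = f + E has nonnegative coefficients up to X = k^2 L^2,
L = log k + log log k, and dominates g there, so up to a tail |h(x + iy)| is at most h(iy). Moving i y0 by the matrix with
rows (1,0), (N,1) to height 1/Y, Y = N^2 y0 + 1/y0, and inverting gives
h(i y0) \<le> (Y/y0)^w h(iY) up to the tail. For Y of order k L the value h(iY) is 2 plus a small multiple
of h(i y0), whence A = O((Y/y0)^w), and the tail beyond X is negligible.
When k is 4 or 8 there are no cusp forms and f = E.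
\<close>

section \<open>Fourier expansions\<close>

text \<open>Every orbit reaches any height below sqrt 3 / 2; 4/5 is a rational choice. The obstacle
  is that nothing is assumed about the coefficients beyond X, where the bound at hand is Hecke's,
  which contains A. The argument is therefore a self-estimate: a majorant P of A satisfies P \<le>
  2R + P/8 + P/8 with R = (Y/y0)^w, one eighth coming from h(iY), the other from the tail. The first
  needs w log Y below about 2 pi Y, whence Y of order k L; the second needs w log n below about 2 pi
  n / Y for n > X, whence X of order (k L)^2. In the final comparison Stirling's formula asks that
  n^(w-1) exceed a constant times (k^2 (Y/y0) / (2 pi e)^2)^w, that is, n of order about k^3 L. The
  threshold k^4 L^2 / 7316 exceeds this by a factor of order k L, whose powers absorb the constants.
  Reality of a(n), given for n \<le> X, extends to all n because the difference of f and its
  conjugate form vanishes to high order at the cusp. Divisibility of k by 4 makes (2 pi i)^k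
  positive, so that E has positive coefficients.\<close>

definition qmod :: "real \<Rightarrow> real" where
  "qmod y = exp (- (2 * pi * y))"

lemma qmod_pos [simp]: "qmod y > 0" and qmod_nonneg [simp]: "qmod y \<ge> 0"
  by (simp_all add: qmod_def)

lemma qmod_nonzero [simp]: "qmod y \<noteq> 0"
  by (simp add: qmod_def)

lemma qmod_add: "qmod (x + y) = qmod x * qmod y"
  by (simp add: qmod_def exp_add [symmetric] algebra_simps)

lemma qmod_less_1: "y > 0 \<Longrightarrow> qmod y < 1"
  by (simp add: qmod_def)

lemma qmod_mono: "x \<le> y \<Longrightarrow> qmod y \<le> qmod x"
  by (simp add: qmod_def)

lemma qmod_power: "qmod y ^ n = exp (- (2 * pi * real n * y))"
  by (simp add: qmod_def exp_of_nat_mult [symmetric] mult_ac)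

lemma norm_qpar: "norm (qpar z) = qmod (Im z)"
  by (simp add: qpar_def qmod_def)

lemma qpar_add_1: "qpar (z + 1) = qpar z"
  by (simp add: qpar_def exp_eq algebra_simps)

lemma qpar_minus_cnj: "qpar (- cnj z) = cnj (qpar z)"
  by (simp add: qpar_def exp_cnj)

lemma qpar_imaginary: "qpar (\<i> * of_real y) = of_real (qmod y)"
proof -
  have "2 * pi * \<i> * (\<i> * of_real y) = complex_of_real (- (2 * pi * y))"
    by (simp add: complex_eq_iff)
  then show ?thesis
    by (simp only: qpar_def qmod_def exp_of_real)
qed

lemma ex_qpar:
  assumes "w \<noteq> 0"
  shows "\<exists>z. qpar z = w"
  by (rule exI[of _ "Ln w / (2 * pi * \<i>)"]) (use assms in \<open>simp add: qpar_def\<close>)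

lemma ex_qpar_height:
  assumes "norm w = qmod y"
  shows "\<exists>z. qpar z = w \<and> Im z = y"
proof -
  have "w \<noteq> 0"
    using assms qmod_pos[of y] by (metis norm_zero less_irrefl)
  then obtain z where z: "qpar z = w"
    using ex_qpar by blast
  then have "qmod (Im z) = qmod y"
    using assms norm_qpar by metis
  with z show ?thesis
    by (auto simp: qmod_def)
qed

lemma upper_half_plane_iff [simp]: "z \<in> upper_half_plane \<longleftrightarrow> Im z > 0"
  by (simp add: upper_half_plane_def)

lemma open_upper_half_plane: "open upper_half_plane"
  unfolding upper_half_plane_def by (rule open_halfspace_Im_gt)

lemma fourier_coeffs_sums:
  "fourier_coeffs f c \<Longrightarrow> Im z > 0 \<Longrightarrow> (\<lambda>n. c n * qpar z ^ n) sums f z"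
  by (simp add: fourier_coeffs_def)

lemma fourier_coeffs_summable_norm:
  assumes "fourier_coeffs f c" "norm w < 1"
  shows "summable (\<lambda>n. norm (c n * w ^ n))"
proof -
  obtain r where r: "norm w < r" "r < 1"
    using assms(2) dense by blast
  then have "r > 0"
    using norm_ge_zero[of w] by linarith
  obtain z where z: "qpar z = complex_of_real r"
    using ex_qpar[of "complex_of_real r"] \<open>r > 0\<close> by auto
  have "norm (qpar z) = r"
    using z \<open>r > 0\<close> by simp
  then have "qmod (Im z) < 1"
    using r by (simp add: norm_qpar)
  then have "Im z > 0"
    by (simp add: qmod_def zero_less_mult_iff)
  then have "summable (\<lambda>n. c n * complex_of_real r ^ n)"
    using fourier_coeffs_sums[OF assms(1)] z by (metis sums_summable)
  then show ?thesis
    by (rule powser_insidea) (use r \<open>r > 0\<close> in auto)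
qed

lemma fourier_coeffs_summable_qmod:
  assumes "fourier_coeffs f c" "y > 0"
  shows "summable (\<lambda>n. norm (c n) * qmod y ^ n)"
  using fourier_coeffs_summable_norm[OF assms(1), of "of_real (qmod y)"] qmod_less_1[OF assms(2)]
  by (simp add: norm_mult norm_power)

lemma fourier_coeffs_diff:
  "fourier_coeffs f a \<Longrightarrow> fourier_coeffs g b \<Longrightarrow> fourier_coeffs (\<lambda>z. f z - g z) (\<lambda>n. a n - b n)"
  unfolding fourier_coeffs_def by (auto simp: left_diff_distrib intro!: sums_diff)

lemma fourier_coeffs_add:
  "fourier_coeffs f a \<Longrightarrow> fourier_coeffs g b \<Longrightarrow> fourier_coeffs (\<lambda>z. f z + g z) (\<lambda>n. a n + b n)"
  unfolding fourier_coeffs_def by (auto simp: distrib_right intro!: sums_add)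

lemma fourier_coeffs_cnj:
  assumes "fourier_coeffs f a"
  shows "fourier_coeffs (\<lambda>z. cnj (f (- cnj z))) (\<lambda>n. cnj (a n))"
  unfolding fourier_coeffs_def
proof
  fix z assume "z \<in> upper_half_plane"
  then have "(\<lambda>n. a n * qpar (- cnj z) ^ n) sums f (- cnj z)"
    by (intro fourier_coeffs_sums[OF assms]) auto
  then have "(\<lambda>n. cnj (a n * qpar (- cnj z) ^ n)) sums cnj (f (- cnj z))"
    by (subst sums_cnj)
  then show "(\<lambda>n. cnj (a n) * qpar z ^ n) sums cnj (f (- cnj z))"
    by (simp add: qpar_minus_cnj)
qed

text \<open>Cauchy's inequality for the power series in q on the circle of radius
  \<open>qmod y\<close>, the image of the line at height y. It replaces the Fourier integral over a
  period.\<close>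

lemma fourier_coeffs_norm_le:
  assumes f: "fourier_coeffs f c" and y: "y > 0"
    and B: "\<And>z. Im z = y \<Longrightarrow> norm (f z) \<le> B"
  shows "norm (c n) * qmod y ^ n \<le> B"
proof -
  define P where "P w = (\<Sum>n. c n * w ^ n)" for w
  have P: "(\<lambda>n. c n * w ^ n) sums P w" if "norm w < 1" for w
    unfolding P_def
    by (rule summable_sums[OF summable_norm_cancel[OF fourier_coeffs_summable_norm[OF f that]]])
  have hol: "P holomorphic_on ball 0 1"
    by (rule power_series_holomorphic[where a = c]) (use P in auto)
  have "P has_fps_expansion Abs_fps c"
  proof (rule has_fps_expansionI)
    have "eventually (\<lambda>w. w \<in> ball 0 1) (nhds (0::complex))"
      by (intro eventually_nhds_in_open) auto
    then show "\<forall>\<^sub>F w in nhds 0. (\<lambda>n. fps_nth (Abs_fps c) n * w ^ n) sums P w"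
      by eventually_elim (use P in auto)
  qed
  then have cn: "c n = (deriv ^^ n) P 0 / fact n"
    using fps_nth_fps_expansion[of P "Abs_fps c" n] by simp
  have "norm ((deriv ^^ n) P 0) \<le> fact n * B / qmod y ^ n"
  proof (rule Cauchy_inequality)
    show "P holomorphic_on ball 0 (qmod y)"
      using hol by (rule holomorphic_on_subset) (use y qmod_less_1[of y] in auto)
    show "continuous_on (cball 0 (qmod y)) P"
      using holomorphic_on_imp_continuous_on[OF hol]
      by (rule continuous_on_subset) (use y qmod_less_1[of y] in auto)
    show "norm (P w) \<le> B" if w: "norm (0 - w) = qmod y" for w
    proof -
      obtain z where z: "qpar z = w" "Im z = y"
        using ex_qpar_height w by auto
      then have "P w = f z"
        using sums_unique2[OF P[of w]] fourier_coeffs_sums[OF f, of z] w qmod_less_1[OF y] y by simp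
      then show ?thesis
        using B[OF z(2)] by simp
    qed
  qed simp
  then show ?thesis
    by (simp add: cn norm_divide field_simps)
qed

lemma fourier_norm_le:
  assumes "fourier_coeffs f c" "Im z > 0"
  shows "norm (f z) \<le> (\<Sum>n. norm (c n) * qmod (Im z) ^ n)"
proof -
  have "norm (\<Sum>n. c n * qpar z ^ n) \<le> (\<Sum>n. norm (c n * qpar z ^ n))"
    using fourier_coeffs_summable_norm[OF assms(1), of "qpar z"] qmod_less_1[OF assms(2)]
    by (intro summable_norm) (simp add: norm_qpar)
  then show ?thesis
    using fourier_coeffs_sums[OF assms] by (simp add: sums_iff norm_mult norm_power norm_qpar)
qed

section \<open>Invariance under the modular group and growth of coefficients\<close>

text \<open>Holomorphy and boundedness at the cusp are left out: the existence of a Fourier expansion implies both.\<close>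

definition weakly_modular :: "nat \<Rightarrow> (complex \<Rightarrow> complex) \<Rightarrow> bool" where
  "weakly_modular k f \<longleftrightarrow>
     (\<forall>z. Im z > 0 \<longrightarrow> f (z + 1) = f z \<and> f (- 1 / z) = z ^ k * f z)"

lemma modular_form_imp_weakly_modular: "modular_form k f \<Longrightarrow> weakly_modular k f"
  by (simp add: modular_form_def weakly_modular_def)

lemma weakly_modular_add:
  "weakly_modular k f \<Longrightarrow> weakly_modular k g \<Longrightarrow> weakly_modular k (\<lambda>z. f z + g z)"
  by (simp add: weakly_modular_def distrib_left)

lemma weakly_modular_diff:
  "weakly_modular k f \<Longrightarrow> weakly_modular k g \<Longrightarrow> weakly_modular k (\<lambda>z. f z - g z)"
  by (simp add: weakly_modular_def right_diff_distrib)

lemma Im_minus_inverse: "Im (- 1 / z) = Im z / (norm z)\<^sup>2"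
  by (simp add: Im_divide cmod_power2)

text \<open>This is the form with conjugated coefficients; comparing it with f will show that the
  coefficients of f are real. Evenness of k absorbs the sign in \<open>- cnj z\<close>.\<close>

lemma weakly_modular_cnj:
  assumes "weakly_modular k f" "even k"
  shows "weakly_modular k (\<lambda>z. cnj (f (- cnj z)))"
  unfolding weakly_modular_def
proof (intro allI impI conjI)
  fix z :: complex assume z: "Im z > 0"
  have "Im (- cnj z - 1) > 0"
    using z by simp
  then have "f (- cnj z - 1 + 1) = f (- cnj z - 1)"
    using assms(1) unfolding weakly_modular_def by blast
  then show "cnj (f (- cnj (z + 1))) = cnj (f (- cnj z))"
    by simp
  have "Im (- cnj z) > 0"
    using z by simp
  then have "f (- 1 / (- cnj z)) = (- cnj z) ^ k * f (- cnj z)"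
    using assms(1) unfolding weakly_modular_def by blast
  then show "cnj (f (- cnj (- 1 / z))) = z ^ k * cnj (f (- cnj z))"
    using assms(2) by simp
qed

text \<open>A point below height 4/5 can be translated to real part at most 1/2 in absolute value;
  its squared norm is then at most 1/4 + 16/25 = 89/100, so inversion raises the height by a factor
  of at least 100/89. Finitely many such moves reach height 4/5, without any fundamental
  domain.\<close>

lemma modular_invariant_le:
  fixes \<phi> :: "complex \<Rightarrow> real"
  assumes T: "\<And>z. Im z > 0 \<Longrightarrow> \<phi> (z + 1) = \<phi> z"
    and S: "\<And>z. Im z > 0 \<Longrightarrow> \<phi> (- 1 / z) = \<phi> z"
    and M: "\<And>z. Im z \<ge> 4/5 \<Longrightarrow> \<phi> z \<le> M"
    and z: "Im z > 0"
  shows "\<phi> z \<le> M"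
proof -
  have T_nat: "\<phi> (z + of_nat n) = \<phi> z" if "Im z > 0" for z n
  proof (induction n)
    case (Suc n)
    then show ?case
      using T[of "z + of_nat n"] that by (simp add: add_ac)
  qed simp
  have T_int: "\<phi> (z + of_int m) = \<phi> z" if "Im z > 0" for z m
  proof (cases m rule: int_cases2)
    case (nonneg n)
    then show ?thesis
      using T_nat[OF that] by simp
  next
    case (nonpos n)
    then show ?thesis
      using T_nat[of "z - of_nat n" n] that by simp
  qed
  \<comment> \<open>The number n bounds how many inversions are needed from the given
    height.\<close>
  have *: "\<phi> z \<le> M" if "Im z > 0" "Im z \<ge> 4/5 * (89/100) ^ n" for z n
    using that
  proof (induction n arbitrary: z)
    case 0
    then show ?case
      using M by simp
  next
    case (Suc n)
    show ?case
    proof (cases "Im z \<ge> 4/5")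
      case False
      define u where "u = z + of_int (- round (Re z))"
      have "\<bar>Re u\<bar> \<le> 1/2"
        using of_int_round_abs_le[of "Re z"] unfolding u_def by (simp add: abs_minus_commute)
      then have "\<bar>Re u\<bar>\<^sup>2 \<le> (1/2)\<^sup>2"
        by (rule power_mono) simp
      moreover have "(Im u)\<^sup>2 \<le> (4/5)\<^sup>2"
        using False Suc.prems(1) by (intro power_mono) (auto simp: u_def)
      ultimately have u2: "(norm u)\<^sup>2 \<le> 89/100"
        unfolding cmod_power2 by (simp add: power2_eq_square)
      have Im_u: "Im u = Im z"
        by (simp add: u_def)
      then have "norm u > 0"
        using Suc.prems(1) by auto
      then have pos: "Im (- 1 / u) > 0"
        unfolding Im_minus_inverse Im_u using Suc.prems(1) by simp
      have "4/5 * (89/100) ^ n \<le> Im z / (89/100)"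
        using Suc.prems(2) by (simp add: field_simps)
      also have "\<dots> \<le> Im z / (norm u)\<^sup>2"
        using u2 \<open>norm u > 0\<close> Suc.prems(1) by (intro divide_left_mono) auto
      finally have "\<phi> (- 1 / u) \<le> M"
        by (intro Suc.IH pos) (simp only: Im_minus_inverse Im_u)
      then have "\<phi> u \<le> M"
        using S[of u] Im_u Suc.prems(1) by simp
      then show ?thesis
        using T_int[OF Suc.prems(1), of "- round (Re z)"] by (simp only: u_def)
    qed (use M in blast)
  qed
  obtain n where "(89/100) ^ n < Im z"
    using real_arch_pow_inv[of "Im z" "89/100"] z by auto
  moreover have "0 \<le> (89/100 :: real) ^ n"
    by simp
  ultimately show ?thesis
    by (intro *[of z n] z) linarith
qed

text \<open>Under inversion \<open>Im z ^ w\<close> is divided by |z|^(2w), exactly the factor that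
  |g| gains.\<close>

lemma weakly_modular_height_le:
  assumes g: "weakly_modular (2 * w) g"
    and M: "\<And>z. Im z \<ge> 4/5 \<Longrightarrow> Im z ^ w * norm (g z) \<le> M"
    and z: "Im z > 0"
  shows "Im z ^ w * norm (g z) \<le> M"
proof (rule modular_invariant_le[where \<phi> = "\<lambda>z. Im z ^ w * norm (g z)", OF _ _ M z])
  fix z :: complex assume z: "Im z > 0"
  show "Im (z + 1) ^ w * norm (g (z + 1)) = Im z ^ w * norm (g z)"
    using g z by (simp add: weakly_modular_def)
  have "norm z > 0"
    using z by auto
  moreover have "g (- 1 / z) = z ^ (2 * w) * g z"
    using g z by (simp add: weakly_modular_def)
  ultimately show "Im (- 1 / z) ^ w * norm (g (- 1 / z)) = Im z ^ w * norm (g z)"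
    unfolding Im_minus_inverse by (simp add: norm_mult norm_power power_divide power_mult)
qed auto

section \<open>Hecke's bound for the coefficients of cusp forms\<close>

lemma power_times_qmod_le:
  assumes "y > 0" "w > 0"
  shows "y ^ w * qmod y \<le> (real w / (2 * pi)) ^ w * exp (- real w)"
proof -
  \<comment> \<open>The maximum of y^w exp (-2 pi y) lies at y = w / (2 pi), that is t = 1, where t
    \<le> exp (t - 1) is an equality; so the bound is attained.\<close>
  define t where "t = 2 * pi * y / w"
  have "t \<le> exp (t - 1)"
    using exp_ge_add_one_self[of "t - 1"] by simp
  moreover have "t \<ge> 0"
    using assms by (simp add: t_def)
  ultimately have "t ^ w \<le> exp (t - 1) ^ w"
    by (rule power_mono)
  also have "\<dots> = exp (2 * pi * y - w)"
    using assms by (simp add: exp_of_nat_mult [symmetric] t_def field_simps)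
  finally have "(w / (2 * pi)) ^ w * t ^ w \<le> (w / (2 * pi)) ^ w * exp (2 * pi * y - w)"
    by (intro mult_left_mono) auto
  also have "(w / (2 * pi)) ^ w * t ^ w = y ^ w"
    using assms by (simp add: power_mult_distrib [symmetric] t_def)
  finally have "y ^ w * qmod y \<le> (w / (2 * pi)) ^ w * exp (2 * pi * y - w) * qmod y"
    by (intro mult_right_mono) auto
  then show ?thesis
    by (simp add: qmod_def mult.assoc exp_add [symmetric])
qed

text \<open>Without a constant term, every term shrinks at least as fast as the one for n =
  1.\<close>

lemma qmod_series_decay:
  fixes p :: "nat \<Rightarrow> real"
  assumes p: "\<And>n. p n \<ge> 0" "p 0 = 0" and s: "summable (\<lambda>n. p n * qmod x ^ n)" and xy: "x \<le> y"
  shows "summable (\<lambda>n. p n * qmod y ^ n)"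
    and "(\<Sum>n. p n * qmod y ^ n) \<le> qmod (y - x) * (\<Sum>n. p n * qmod x ^ n)"
proof -
  have le: "p n * qmod y ^ n \<le> qmod (y - x) * (p n * qmod x ^ n)" for n
  proof (cases "n = 0")
    case False
    have "qmod (y - x) \<le> 1"
      using xy by (simp add: qmod_def)
    then have "qmod (y - x) ^ n \<le> qmod (y - x) ^ 1"
      using False by (intro power_decreasing) auto
    then have "qmod (y - x) ^ n * (p n * qmod x ^ n) \<le> qmod (y - x) * (p n * qmod x ^ n)"
      using p by (intro mult_right_mono) auto
    also have "qmod (y - x) ^ n * (p n * qmod x ^ n) = p n * qmod y ^ n"
      using qmod_add[of "y - x" x] by (simp add: power_mult_distrib)
    finally show ?thesis .
  qed (use p in simp)
  show s': "summable (\<lambda>n. p n * qmod y ^ n)"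
    by (rule summable_comparison_test'[OF summable_mult[OF s, of "qmod (y - x)"], of 0]) (use le p in auto)
  have "(\<Sum>n. p n * qmod y ^ n) \<le> (\<Sum>n. qmod (y - x) * (p n * qmod x ^ n))"
    by (intro suminf_le le s' summable_mult s)
  then show "(\<Sum>n. p n * qmod y ^ n) \<le> qmod (y - x) * (\<Sum>n. p n * qmod x ^ n)"
    using suminf_mult[OF s] by simp
qed

lemma cusp_form_bounded:
  assumes g: "fourier_coeffs g c" "weakly_modular (2 * w) g" and c0: "c 0 = 0"
    and w: "w > 0" and z: "Im z > 0"
  defines "A \<equiv> \<Sum>m. norm (c m) * qmod (4/5) ^ m"
  shows "Im z ^ w * norm (g z) \<le> (real w / (2 * pi)) ^ w * exp (- real w) * (A / qmod (4/5))"
proof (rule weakly_modular_height_le[OF g(2) _ z])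
  have s: "summable (\<lambda>m. norm (c m) * qmod (4/5) ^ m)"
    by (rule fourier_coeffs_summable_qmod[OF g(1)]) simp
  have A: "A \<ge> 0"
    unfolding A_def by (intro suminf_nonneg s) auto
  fix z :: complex assume z: "Im z \<ge> 4/5"
  have "norm (g z) \<le> (\<Sum>m. norm (c m) * qmod (Im z) ^ m)"
    by (rule fourier_norm_le[OF g(1)]) (use z in auto)
  also have "\<dots> \<le> qmod (Im z - 4/5) * A"
    unfolding A_def by (rule qmod_series_decay(2)[OF _ _ s z]) (use c0 in auto)
  also have "\<dots> = qmod (Im z) * (A / qmod (4/5))"
    using qmod_add[of "Im z - 4/5" "4/5"] by (simp add: field_simps)
  finally have "Im z ^ w * norm (g z) \<le> Im z ^ w * (qmod (Im z) * (A / qmod (4/5)))"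
    using z by (intro mult_left_mono) auto
  also have "\<dots> = (Im z ^ w * qmod (Im z)) * (A / qmod (4/5))"
    by simp
  also have "\<dots> \<le> (real w / (2 * pi)) ^ w * exp (- real w) * (A / qmod (4/5))"
    using z w A by (intro mult_right_mono power_times_qmod_le) auto
  finally show "Im z ^ w * norm (g z) \<le> (real w / (2 * pi)) ^ w * exp (- real w) * (A / qmod (4/5))" .
qed

lemma cusp_form_coeff_le:
  assumes g: "fourier_coeffs g c" "weakly_modular (2 * w) g" and c0: "c 0 = 0"
    and w: "w > 0" and n: "n > 0"
  defines "A \<equiv> \<Sum>m. norm (c m) * qmod (4/5) ^ m"
  shows "norm (c n) \<le> A / qmod (4/5) * real n ^ w"
proof -
  define M where "M = (real w / (2 * pi)) ^ w * exp (- real w) * (A / qmod (4/5))"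
  have M: "Im z ^ w * norm (g z) \<le> M" if "Im z > 0" for z
    unfolding M_def A_def by (rule cusp_form_bounded[OF g c0 w that])
  \<comment> \<open>With this height the factor (w / (2 pi))^w exp (-w) of the bound for the form
    cancels exactly, so no constant depending on w remains beside A.\<close>
  define y where "y = real w / (2 * pi * real n)"
  have y: "y > 0"
    using w n by (simp add: y_def)
  have "norm (c n) * qmod y ^ n \<le> M / y ^ w"
    by (rule fourier_coeffs_norm_le[OF g(1) y]) (use M y in \<open>auto simp: field_simps\<close>)
  also have "qmod y ^ n = exp (- real w)"
    unfolding qmod_power y_def using n by simp
  also have "M / y ^ w = A / qmod (4/5) * exp (- real w) * real n ^ w"
    using w n by (simp add: M_def y_def power_divide power_mult_distrib field_simps)
  finally show ?thesis
    by (simp add: field_simps)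
qed

text \<open>Let M bound \<open>Im z ^ w * norm (g z)\<close>. The maximum principle for g / q^m on
  the disc of radius \<open>qmod (7/10)\<close> bounds the same quantity at heights y \<ge> 4/5 by M
  times (y / (7/10))^w exp (-2 pi m (y - 7/10)), and w \<le> 4m keeps this factor below a fixed
  \<theta> < 1. By invariance \<theta> M is again a global bound, and iteration forces g = 0. This
  stands in for the valence formula; it serves with m = 1 to exclude cusp forms of weight 4 and 8,
  and with m = k to prove reality of coefficients.\<close>

lemma modular_form_vanishing:
  assumes g: "fourier_coeffs g c" "weakly_modular (2 * w) g" and c0: "\<And>n. n < m \<Longrightarrow> c n = 0"
    and w: "w > 0" and m: "w \<le> 4 * m"
  shows "c n = 0"
proof -
  have m0: "m > 0" using w m by simp
  \<comment> \<open>The quotient g / q^m as a power series in q, which extends holomorphically over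
    the cusp q = 0.\<close>
  define P where "P v = (\<Sum>n. c (n + m) * v ^ n)" for v
  have P: "(\<lambda>n. c (n + m) * v ^ n) sums P v" if v: "norm v < 1" for v
  proof (cases "v = 0")
    case True
    then show ?thesis
      unfolding P_def by (auto intro!: summable_sums summable_finite[of "{0}"])
  next
    case False
    have "summable (\<lambda>n. c n * v ^ n)"
      by (rule summable_norm_cancel[OF fourier_coeffs_summable_norm[OF g(1) v]])
    then have "summable (\<lambda>n. c (n + m) * v ^ (n + m))"
      by (subst summable_iff_shift)
    then have "summable (\<lambda>n. c (n + m) * v ^ (n + m) / v ^ m)"
      by (rule summable_divide)
    then show ?thesis
      unfolding P_def using False by (intro summable_sums) (simp add: power_add)
  qed
  have gP: "g z = qpar z ^ m * P (qpar z)" if z: "Im z > 0" for z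
  proof -
    have "norm (qpar z) < 1"
      using z by (simp add: norm_qpar qmod_less_1)
    then have "(\<lambda>n. qpar z ^ m * (c (n + m) * qpar z ^ n)) sums (qpar z ^ m * P (qpar z))"
      by (intro sums_mult P)
    then have "(\<lambda>n. c (n + m) * qpar z ^ (n + m)) sums (qpar z ^ m * P (qpar z))"
      by (simp add: power_add mult_ac)
    moreover have "(\<lambda>n. c (n + m) * qpar z ^ (n + m)) sums g z"
      using fourier_coeffs_sums[OF g(1) z] sums_iff_shift[of "\<lambda>n. c n * qpar z ^ n" m "g z"] c0 by simp
    ultimately show ?thesis
      using sums_unique2 by blast
  qed
  have hol: "P holomorphic_on ball 0 1"
    by (rule power_series_holomorphic[where a = "\<lambda>n. c (n + m)"]) (use P in auto)
  \<comment> \<open>maximum principle for g / q^m, comparing the heights 7/10 and Im z\<close>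
  have max: "norm (g z) \<le> B * qmod (Im z - 7/10) ^ m"
    if z: "Im z \<ge> 7/10" and B: "\<And>z. Im z = 7/10 \<Longrightarrow> norm (g z) \<le> B" for z B
  proof -
    have "norm (P (qpar z)) \<le> B / qmod (7/10) ^ m"
    proof (rule maximum_modulus_frontier[where f = P and S = "cball 0 (qmod (7/10))"])
      have sub: "cball 0 (qmod (7/10)) \<subseteq> ball (0::complex) 1"
        using qmod_less_1[of "7/10"] by auto
      show "P holomorphic_on interior (cball 0 (qmod (7/10)))"
        using hol by (rule holomorphic_on_subset) (use sub interior_subset in blast)
      show "continuous_on (closure (cball 0 (qmod (7/10)))) P"
        using holomorphic_on_imp_continuous_on[OF hol] by (rule continuous_on_subset) (use sub in simp)
      show "qpar z \<in> cball 0 (qmod (7/10))"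
        using z by (simp add: norm_qpar qmod_mono)
      show "norm (P v) \<le> B / qmod (7/10) ^ m" if "v \<in> frontier (cball 0 (qmod (7/10)))" for v
      proof -
        have v: "norm v = qmod (7/10)"
          using that by (simp add: frontier_cball)
        then obtain u where u: "qpar u = v" "Im u = 7/10"
          using ex_qpar_height by blast
        have "norm (g u) = qmod (7/10) ^ m * norm (P v)"
          using gP[of u] u v by (simp add: norm_mult norm_power)
        then show ?thesis
          using B[OF u(2)] by (simp add: field_simps)
      qed
    qed auto
    then have "qmod (Im z) ^ m * norm (P (qpar z)) \<le> qmod (Im z) ^ m * (B / qmod (7/10) ^ m)"
      by (intro mult_left_mono) auto
    also have "\<dots> = B * qmod (Im z - 7/10) ^ m"
      using qmod_add[of "Im z - 7/10" "7/10"] qmod_pos[of "7/10"] by (simp add: power_mult_distrib)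
    finally show ?thesis
      using gP[of z] z by (simp add: norm_mult norm_power norm_qpar)
  qed
  define \<theta> where "\<theta> = exp (- (1/100::real))"
  have \<theta>: "\<theta> > 0" "\<theta> < 1"
    by (auto simp: \<theta>_def)
  have step: "Im z ^ w * norm (g z) \<le> \<theta> * M"
    if M: "\<And>z. Im z > 0 \<Longrightarrow> Im z ^ w * norm (g z) \<le> M" and z: "Im z > 0" for z M
  proof (rule weakly_modular_height_le[OF g(2) _ z])
    have "M \<ge> 0"
      using order_trans[OF _ M[OF z]] z by simp
    fix z :: complex assume z: "Im z \<ge> 4/5"
    define y where "y = Im z"
    have "norm (g z) \<le> M / (7/10) ^ w" if "Im z = 7/10" for z
      using M[of z] that by (simp add: pos_le_divide_eq mult.commute)
    then have "norm (g z) \<le> M / (7/10) ^ w * qmod (y - 7/10) ^ m"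
      unfolding y_def by (intro max) (use z in auto)
    then have "y ^ w * norm (g z) \<le> y ^ w * (M / (7/10) ^ w * qmod (y - 7/10) ^ m)"
      using z by (intro mult_left_mono) (auto simp: y_def)
    also have "\<dots> = (y / (7/10)) ^ w * qmod (y - 7/10) ^ m * M"
      by (simp add: power_divide)
    also have "\<dots> \<le> \<theta> * M"
    proof (rule mult_right_mono[OF _ \<open>M \<ge> 0\<close>])
      have "(y / (7/10)) ^ w \<le> exp ((y - 7/10) / (7/10)) ^ w"
        using z exp_ge_add_one_self[of "(y - 7/10) / (7/10)"]
        by (intro power_mono) (auto simp: y_def field_simps)
      also have "\<dots> = exp (real w * ((y - 7/10) / (7/10)))"
        by (simp only: exp_of_nat_mult)
      also have "\<dots> \<le> exp (real m * (6 * (y - 7/10)) - 1/100)"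
      proof -
        \<comment> \<open>The slope 4m / (7/10) is (6 - 2/7) m, less than 2 pi m. The surplus 2/7 (y
          - 7/10) is at least 1/35 for y \<ge> 4/5, hence above the 1/100 in \<theta>.\<close>
        have "real w * ((y - 7/10) / (7/10)) \<le> 4 * real m * ((y - 7/10) / (7/10))"
          using m z by (intro mult_right_mono) (auto simp: y_def)
        also have "\<dots> = real m * (6 * (y - 7/10)) - real m * (2/7 * (y - 7/10))"
          by (simp add: field_simps)
        also have "1 * (1/100) \<le> real m * (2/7 * (y - 7/10))"
          using m0 z by (intro mult_mono) (auto simp: y_def)
        then have "real m * (6 * (y - 7/10)) - real m * (2/7 * (y - 7/10)) \<le> real m * (6 * (y - 7/10)) - 1/100"
          by (intro diff_left_mono) simp
        finally show ?thesis
          unfolding exp_le_cancel_iff .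
      qed
      finally have 1: "(y / (7/10)) ^ w \<le> exp (real m * (6 * (y - 7/10)) - 1/100)" .
      have "6 * (y - 7/10) \<le> 2 * pi * (y - 7/10)"
        using pi_gt3 z by (intro mult_right_mono) (auto simp: y_def)
      then have "real m * (6 * (y - 7/10)) \<le> real m * (2 * pi * (y - 7/10))"
        by (intro mult_left_mono) auto
      then have 2: "qmod (y - 7/10) ^ m \<le> exp (- (real m * (6 * (y - 7/10))))"
        unfolding qmod_power by (simp add: mult_ac)
      have "(y / (7/10)) ^ w * qmod (y - 7/10) ^ m \<le>
          exp (real m * (6 * (y - 7/10)) - 1/100) * exp (- (real m * (6 * (y - 7/10))))"
        by (intro mult_mono 1 2) auto
      also have "\<dots> = \<theta>"
        by (simp add: \<theta>_def flip: exp_add)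
      finally show "(y / (7/10)) ^ w * qmod (y - 7/10) ^ m \<le> \<theta>" .
    qed
    finally show "Im z ^ w * norm (g z) \<le> \<theta> * M"
      by (simp add: y_def)
  qed
  obtain M where M: "\<And>z. Im z > 0 \<Longrightarrow> Im z ^ w * norm (g z) \<le> M"
    using cusp_form_bounded[OF g c0[OF m0] w] by blast
  have iter: "Im z ^ w * norm (g z) \<le> \<theta> ^ j * M" if "Im z > 0" for j z
    using that
  proof (induction j arbitrary: z)
    case (Suc j)
    then show ?case
      using step[of "\<theta> ^ j * M" z] by (simp add: mult_ac)
  qed (use M in simp)
  have "g z = 0" if z: "Im z > 0" for z
  proof -
    have "(\<lambda>j. \<theta> ^ j * M) \<longlonglongrightarrow> 0 * M"
      by (intro tendsto_mult LIMSEQ_power_zero tendsto_const) (use \<theta> in auto)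
    then have "Im z ^ w * norm (g z) \<le> 0 * M"
      by (rule LIMSEQ_le_const) (use iter[OF z] in auto)
    then show ?thesis
      using zero_less_power[OF z, of w] by (simp add: mult_le_0_iff)
  qed
  then have "norm (c n) * qmod 1 ^ n \<le> 0"
    by (intro fourier_coeffs_norm_le[OF g(1)]) auto
  then show ?thesis
    using zero_less_power[OF qmod_pos, of 1 n] by (simp add: mult_le_0_iff)
qed

section \<open>The Lipschitz formula\<close>

lemma summable_of_nat_power_powser:
  fixes v :: complex
  assumes "norm v < 1"
  shows "summable (\<lambda>n. of_nat n ^ j * v ^ n)"
  using assms
proof (induction j arbitrary: v)
  case 0
  then show ?case
    by (simp add: summable_geometric)
next
  case (Suc j)
  have "summable (\<lambda>n. diffs (\<lambda>n. of_nat n ^ j) n * v ^ n)"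
    by (rule termdiff_converges[OF Suc.prems]) (use Suc.IH in blast)
  then have "summable (\<lambda>n. v * (diffs (\<lambda>n. of_nat n ^ j) n * v ^ n))"
    by (rule summable_mult)
  then have "summable (\<lambda>n. of_nat (Suc n) ^ Suc j * v ^ Suc n)"
    by (simp add: diffs_def mult_ac)
  then show ?case
    by (subst (asm) summable_Suc_iff)
qed

lemma has_field_derivative_power_qpar_series:
  fixes z :: complex
  assumes z: "Im z > 0"
  shows "((\<lambda>z. \<Sum>n. of_nat n ^ j * qpar z ^ n) has_field_derivative
           2 * pi * \<i> * (\<Sum>n. of_nat n ^ Suc j * qpar z ^ n)) (at z)"
proof -
  define v where "v = qpar z"
  have v: "norm v < 1"
    using z by (simp add: v_def norm_qpar qmod_less_1)
  define D where "D = (\<Sum>n. diffs (\<lambda>n. of_nat n ^ j) n * v ^ n)"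
  have "((\<lambda>v. \<Sum>n. of_nat n ^ j * v ^ n) has_field_derivative D) (at (qpar z))"
    unfolding D_def v_def[symmetric] using v summable_of_nat_power_powser
    by (intro termdiffs_strong'[where K = 1]) auto
  moreover have "(qpar has_field_derivative 2 * pi * \<i> * v) (at z)"
    unfolding qpar_def v_def by (auto intro!: derivative_eq_intros)
  ultimately have "((\<lambda>z. \<Sum>n. of_nat n ^ j * qpar z ^ n) has_field_derivative D * (2 * pi * \<i> * v)) (at z)"
    by (rule DERIV_chain2)
  moreover have "D * v = (\<Sum>n. of_nat n ^ Suc j * v ^ n)"
  proof -
    have s: "summable (\<lambda>n. diffs (\<lambda>n. of_nat n ^ j) n * v ^ n)"
      by (rule termdiff_converges[OF v]) (use summable_of_nat_power_powser in blast)
    have "D * v = (\<Sum>n. diffs (\<lambda>n. of_nat n ^ j) n * v ^ n * v)"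
      unfolding D_def by (rule suminf_mult2[OF s])
    also have "\<dots> = (\<Sum>n. of_nat (Suc n) ^ Suc j * v ^ Suc n)"
      by (simp add: diffs_def mult_ac)
    also have "\<dots> = (\<Sum>n. of_nat n ^ Suc j * v ^ n)"
      using suminf_split_head[OF summable_of_nat_power_powser[OF v, of "Suc j"]] by simp
    finally show ?thesis .
  qed
  moreover have "D * (2 * pi * \<i> * v) = 2 * pi * \<i> * (D * v)"
    by simp
  ultimately show ?thesis
    by (simp only: v_def)
qed

lemma not_in_Ints_upper: "Im z > 0 \<Longrightarrow> z \<notin> \<int>" and not_in_Ints_upper': "Im z > 0 \<Longrightarrow> 1 - z \<notin> \<int>"
  by (auto elim!: Ints_cases simp: complex_eq_iff)

text \<open>Logarithmic derivative of the reflection formula for Gamma. It gives the partial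
  fractions of the cotangent in the form of two one-sided series, whose derivatives are Polygamma
  functions.\<close>

lemma Digamma_reflection:
  fixes z :: complex
  assumes "z \<notin> \<int>"
  shows "Digamma (1 - z) - Digamma z = pi * cos (pi * z) / sin (pi * z)"
proof -
  have z: "z \<notin> \<int>\<^sub>\<le>\<^sub>0" "1 - z \<notin> \<int>\<^sub>\<le>\<^sub>0"
    using assms nonpos_Ints_subset_Ints Ints_diff[of 1 "1 - z"] by auto
  have sin: "sin (pi * z) \<noteq> 0"
    using assms by (auto simp: sin_eq_0 mult.commute)
  have Gamma: "Gamma z * Gamma (1 - z) = pi / sin (pi * z)"
    by (rule Gamma_reflection_complex)
  have "((\<lambda>z. Gamma z * Gamma (1 - z)) has_field_derivative
          (Gamma z * Gamma (1 - z)) * (Digamma z - Digamma (1 - z))) (at z)"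
    using z by (auto intro!: derivative_eq_intros simp: algebra_simps)
  moreover have "((\<lambda>z. Gamma z * Gamma (1 - z)) has_field_derivative
          - (pi / sin (pi * z) * (pi * cos (pi * z) / sin (pi * z)))) (at z)"
    unfolding Gamma_reflection_complex
    using sin by (auto intro!: derivative_eq_intros simp: power2_eq_square)
  ultimately have "(pi / sin (pi * z)) * (Digamma z - Digamma (1 - z)) =
      (pi / sin (pi * z)) * - (pi * cos (pi * z) / sin (pi * z))"
    unfolding Gamma using DERIV_unique by fastforce
  then have "Digamma z - Digamma (1 - z) = - (pi * cos (pi * z) / sin (pi * z))"
    using sin by (subst (asm) mult_left_cancel) auto
  then show ?thesis
    by (simp add: algebra_simps)
qed

lemma cot_qpar:
  fixes z :: complex
  assumes "Im z > 0"
  shows "pi * cos (pi * z) / sin (pi * z) = pi * \<i> - 2 * pi * \<i> * (\<Sum>n. qpar z ^ n)"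
proof -
  define u where "u = exp (\<i> * (pi * z))"
  have u: "u \<noteq> 0"
    by (simp add: u_def)
  have q: "qpar z = u\<^sup>2"
    by (simp add: u_def qpar_def power2_eq_square mult_ac flip: exp_add)
  have lt: "norm (u\<^sup>2) < 1"
    using assms by (simp add: norm_qpar qmod_less_1 flip: q)
  then have u1: "u\<^sup>2 \<noteq> 1"
    by (metis less_irrefl norm_one)
  have e: "exp (- (\<i> * (pi * z))) = 1 / u"
    by (simp add: u_def exp_minus divide_inverse)
  have nz: "u - 1 / u \<noteq> 0"
    using u u1 by (simp add: field_simps power2_eq_square)
  have "pi * cos (pi * z) / sin (pi * z) = pi * \<i> * (u + 1 / u) / (u - 1 / u)"
  proof -
    define s where "s = u - 1 / u"
    define t where "t = u + 1 / u"
    have cs: "cos (pi * z) = t / 2" "sin (pi * z) = s / (2 * \<i>)"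
      by (simp_all add: cos_exp_eq sin_exp_eq e s_def t_def flip: u_def)
    have "s \<noteq> 0"
      using nz by (simp add: s_def)
    then show ?thesis
      unfolding cs s_def[symmetric] t_def[symmetric] by (simp add: field_simps)
  qed
  also have "\<dots> = pi * \<i> - 2 * pi * \<i> * (1 / (1 - u\<^sup>2))"
    using u u1 nz by (simp add: divide_simps) (simp add: algebra_simps power2_eq_square)
  also have "1 / (1 - u\<^sup>2) = (\<Sum>n. qpar z ^ n)"
    unfolding q using suminf_geometric[OF lt] by simp
  finally show ?thesis .
qed

text \<open>The case j = 0 is the cotangent in terms of q; the rest follows by differentiating j
  times. The series starts at n = 0: for j = 0 this term is 1, for j > 0 it vanishes, as does the
  derivative of the constant pi i.\<close>

lemma Polygamma_reflection_qpar:
  fixes z :: complex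
  assumes "Im z > 0"
  shows "(- 1) ^ j * Polygamma j (1 - z) - Polygamma j z =
    (if j = 0 then pi * \<i> else 0) - (2 * pi * \<i>) ^ Suc j * (\<Sum>n. of_nat n ^ j * qpar z ^ n)"
  using assms
proof (induction j arbitrary: z)
  case 0
  then show ?case
    using Digamma_reflection[OF not_in_Ints_upper] cot_qpar by simp
next
  case (Suc j)
  let ?L = "\<lambda>z. (- 1) ^ j * Polygamma j (1 - z) - Polygamma j z"
  let ?R = "\<lambda>z. (if j = 0 then pi * \<i> else 0) - (2 * pi * \<i>) ^ Suc j * (\<Sum>n. of_nat n ^ j * qpar z ^ n)"
  have z: "z \<notin> \<int>\<^sub>\<le>\<^sub>0" "1 - z \<notin> \<int>\<^sub>\<le>\<^sub>0"
    using not_in_Ints_upper not_in_Ints_upper' Suc.prems nonpos_Ints_subset_Ints by blast+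
  have L: "(?L has_field_derivative (- 1) ^ Suc j * Polygamma (Suc j) (1 - z) - Polygamma (Suc j) z) (at z)"
    using z by (auto intro!: derivative_eq_intros)
  have R: "(?R has_field_derivative
      - ((2 * pi * \<i>) ^ Suc j * (2 * pi * \<i> * (\<Sum>n. of_nat n ^ Suc j * qpar z ^ n)))) (at z)"
    using has_field_derivative_power_qpar_series[OF Suc.prems, of j]
    by (auto intro!: derivative_eq_intros)
  have ev: "eventually (\<lambda>z. ?L z = ?R z) (nhds z)"
  proof -
    have "eventually (\<lambda>z. z \<in> upper_half_plane) (nhds z)"
      using Suc.prems by (intro eventually_nhds_in_open open_upper_half_plane) simp
    then show ?thesis
      by (rule eventually_mono) (rule Suc.IH, simp)
  qed
  from R have "(?L has_field_derivative
      - ((2 * pi * \<i>) ^ Suc j * (2 * pi * \<i> * (\<Sum>n. of_nat n ^ Suc j * qpar z ^ n)))) (at z)"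
    by (subst DERIV_cong_ev[OF refl ev refl])
  with L have "(- 1) ^ Suc j * Polygamma (Suc j) (1 - z) - Polygamma (Suc j) z =
      - ((2 * pi * \<i>) ^ Suc j * (2 * pi * \<i> * (\<Sum>n. of_nat n ^ Suc j * qpar z ^ n)))"
    by (rule DERIV_unique)
  then show ?case
    by (simp add: mult_ac)
qed

text \<open>The sum of (z + n)^(-k) over all integers n, split into n = m \<ge> 0 and n = -1 - m <
  0. As k is even, the second half has terms (1 - z + m)^(-k), so each half is a Polygamma
  series.\<close>

lemma Lipschitz_formula_sums:
  fixes z :: complex
  assumes z: "Im z > 0" and k: "even k" "k > 0"
  obtains A B where
    "(\<lambda>m. inverse ((z + of_nat m) ^ k)) sums A"
    "(\<lambda>m. inverse ((1 - z + of_nat m) ^ k)) sums B"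
    "A + B = (2 * pi * \<i>) ^ k / fact (k - 1) * (\<Sum>n. of_nat n ^ (k - 1) * qpar z ^ n)"
proof -
  have "k \<noteq> 1"
    using k by auto
  then have k1: "k - 1 > 0" "Suc (k - 1) = k"
    using k by auto
  have nz: "z \<noteq> 0" "1 - z \<noteq> 0"
    using not_in_Ints_upper[OF z] not_in_Ints_upper'[OF z] by auto
  let ?S = "\<Sum>n. of_nat n ^ (k - 1) * qpar z ^ n"
  have "odd (k - 1)"
    using k by simp
  then have *: "Polygamma (k - 1) (1 - z) + Polygamma (k - 1) z = (2 * pi * \<i>) ^ k * ?S"
    using Polygamma_reflection_qpar[OF z, of "k - 1"] k1 by (simp add: algebra_simps)
  show ?thesis
  proof (rule that)
    show "(\<lambda>m. inverse ((z + of_nat m) ^ k)) sums (Polygamma (k - 1) z / fact (k - 1))"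
      using Polygamma_LIMSEQ[OF nz(1) k1(1)] k1 k by simp
    show "(\<lambda>m. inverse ((1 - z + of_nat m) ^ k)) sums (Polygamma (k - 1) (1 - z) / fact (k - 1))"
      using Polygamma_LIMSEQ[OF nz(2) k1(1)] k1 k by simp
    show "Polygamma (k - 1) z / fact (k - 1) + Polygamma (k - 1) (1 - z) / fact (k - 1) =
      (2 * pi * \<i>) ^ k / fact (k - 1) * ?S"
      using * by (simp add: add_divide_distrib [symmetric] add.commute)
  qed
qed

section \<open>Lattice sums\<close>

definition lattice_term :: "nat \<Rightarrow> complex \<Rightarrow> int \<times> int \<Rightarrow> complex" where
  "lattice_term k z = (\<lambda>(m, n). inverse ((of_int m * z + of_int n) ^ k))"

lemma summable_on_int_inverse_square: "(\<lambda>n::int. 1 / (1 + (of_int n)\<^sup>2 :: real)) summable_on UNIV"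
proof -
  have s: "summable (\<lambda>n. 1 / (1 + (real n)\<^sup>2))"
  proof (rule summable_comparison_test')
    show "summable (\<lambda>n. 1 / (real n)\<^sup>2)"
      using inverse_power_summable[of 2, where 'a = real] by (simp add: divide_inverse)
    fix n :: nat assume "n \<ge> 1"
    then show "norm (1 / (1 + (real n)\<^sup>2)) \<le> 1 / (real n)\<^sup>2"
      by (simp add: frac_le)
  qed
  then have nat: "(\<lambda>n. 1 / (1 + (real n)\<^sup>2)) summable_on UNIV"
    by (intro norm_summable_imp_summable_on) simp
  then have "(\<lambda>n::int. 1 / (1 + (of_int n)\<^sup>2 :: real)) summable_on range int"
    by (subst summable_on_reindex) (auto simp: o_def)
  moreover have "(\<lambda>n::int. 1 / (1 + (of_int n)\<^sup>2 :: real)) summable_on range (\<lambda>n. - int n)"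
    using nat by (subst summable_on_reindex) (auto simp: o_def inj_on_def)
  ultimately have "(\<lambda>n::int. 1 / (1 + (of_int n)\<^sup>2 :: real)) summable_on (range int \<union> range (\<lambda>n. - int n))"
    by (rule summable_on_union)
  moreover have "range int \<union> range (\<lambda>n. - int n) = UNIV"
    by (auto intro: int_cases2)
  ultimately show ?thesis
    by simp
qed

text \<open>Two quadratic forms in (m, n) are compared with an explicit constant instead of a
  compactness argument.\<close>

lemma norm_lattice_point_ge:
  assumes "Im z > 0"
  shows "real_of_int m ^ 2 + real_of_int n ^ 2 \<le>
    (2 + (2 * (Re z)\<^sup>2 + 1) / (Im z)\<^sup>2) * (norm (of_int m * z + of_int n))\<^sup>2"
proof -
  define a b where "a = real_of_int m" and "b = real_of_int n"
  have eq: "(norm (of_int m * z + of_int n))\<^sup>2 = (a * Re z + b)\<^sup>2 + (a * Im z)\<^sup>2"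
    by (simp add: cmod_power2 a_def b_def)
  have "0 \<le> (2 * (a * Re z) + b)\<^sup>2"
    by simp
  then have "b\<^sup>2 \<le> 2 * (a * Re z + b)\<^sup>2 + 2 * (a * Re z)\<^sup>2"
    by (simp add: power2_eq_square algebra_simps)
  then have "a\<^sup>2 + b\<^sup>2 \<le> 2 * (a * Re z + b)\<^sup>2 + (2 * (Re z)\<^sup>2 + 1) * a\<^sup>2"
    by (simp add: algebra_simps power_mult_distrib)
  also have "(2 * (Re z)\<^sup>2 + 1) * a\<^sup>2 = (2 * (Re z)\<^sup>2 + 1) / (Im z)\<^sup>2 * (a * Im z)\<^sup>2"
    using assms by (simp add: power_mult_distrib)
  also have "2 * (a * Re z + b)\<^sup>2 + \<dots> \<le>
      2 * (a * Re z + b)\<^sup>2 + (2 + (2 * (Re z)\<^sup>2 + 1) / (Im z)\<^sup>2) * (a * Im z)\<^sup>2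
        + (2 * (Re z)\<^sup>2 + 1) / (Im z)\<^sup>2 * (a * Re z + b)\<^sup>2"
    by (simp add: algebra_simps)
  also have "\<dots> = (2 + (2 * (Re z)\<^sup>2 + 1) / (Im z)\<^sup>2) * ((a * Re z + b)\<^sup>2 + (a * Im z)\<^sup>2)"
    by (simp add: algebra_simps)
  finally show ?thesis
    by (simp only: eq a_def b_def)
qed

text \<open>With s = m^2 + n^2 \<ge> 1 one has (1 + m^2)(1 + n^2) \<le> 3 s^2, while s^2 \<le> s^w
  and s is at most a constant times |mz + n|^2. So the double series is dominated by a product of
  two convergent simple ones.\<close>

lemma abs_summable_lattice_term:
  assumes z: "Im z > 0" and w: "w \<ge> 2"
  shows "(\<lambda>x. norm (lattice_term (2 * w) z x)) summable_on (- {(0, 0)})"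
proof (rule Infinite_Sum.abs_summable_on_comparison_test')
  define C where "C = 2 + (2 * (Re z)\<^sup>2 + 1) / (Im z)\<^sup>2"
  have C: "C > 0"
    unfolding C_def by (intro add_pos_nonneg) auto
  define g :: "int \<Rightarrow> real" where "g = (\<lambda>n. 1 / (1 + (of_int n)\<^sup>2))"
  have g: "g summable_on UNIV"
    unfolding g_def by (rule summable_on_int_inverse_square)
  have g0: "g n \<ge> 0" for n
    by (simp add: g_def)
  have "(\<lambda>(m, n). g m * g n) summable_on Sigma UNIV (\<lambda>_. UNIV)"
  proof (rule summable_on_SigmaI[where g = "\<lambda>m. g m * infsum g UNIV"])
    show "((\<lambda>n. (\<lambda>(m, n). g m * g n) (m, n)) has_sum g m * infsum g UNIV) UNIV" for m
      using has_sum_cmult_right[OF has_sum_infsum[OF g], of "g m"] by simp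
    show "(\<lambda>m. g m * infsum g UNIV) summable_on UNIV"
      by (rule summable_on_cmult_left[OF g])
  qed (use g0 in auto)
  then have "(\<lambda>x. 3 * C ^ w * (\<lambda>(m, n). g m * g n) x) summable_on UNIV"
    by (intro summable_on_cmult_right) simp
  then show "(\<lambda>x. 3 * C ^ w * (\<lambda>(m, n). g m * g n) x) summable_on (- {(0, 0)})"
    by (rule summable_on_subset) simp
  fix x :: "int \<times> int" assume x: "x \<in> - {(0, 0)}"
  obtain m n where mn: "x = (m, n)"
    by (cases x)
  define s where "s = real_of_int m ^ 2 + real_of_int n ^ 2"
  define N where "N = norm (of_int m * z + of_int n)"
  have "m \<noteq> 0 \<or> n \<noteq> 0"
    using x mn by auto
  then have "m\<^sup>2 + n\<^sup>2 > 0"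
    using sum_power2_gt_zero_iff by blast
  then have "1 \<le> real_of_int (m\<^sup>2 + n\<^sup>2)"
    by linarith
  then have s1: "s \<ge> 1"
    by (simp add: s_def)
  have sN: "s \<le> C * N\<^sup>2"
    unfolding s_def C_def N_def by (rule norm_lattice_point_ge[OF z])
  have "N \<noteq> 0"
    using s1 sN by auto
  then have N: "N > 0"
    by (simp add: N_def)
  have "s\<^sup>2 \<le> s ^ w"
    using s1 w by (rule power_increasing[rotated])
  also have "\<dots> \<le> (C * N\<^sup>2) ^ w"
    using s1 sN by (intro power_mono) auto
  finally have 1: "s\<^sup>2 \<le> C ^ w * N ^ (2 * w)"
    by (simp add: power_mult_distrib power_mult)
  have "(1 + (real_of_int m)\<^sup>2) * (1 + (real_of_int n)\<^sup>2) = 1 + s + (real_of_int m)\<^sup>2 * (real_of_int n)\<^sup>2"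
    by (simp add: s_def algebra_simps)
  also have "(real_of_int m)\<^sup>2 * (real_of_int n)\<^sup>2 \<le> s * s"
    unfolding s_def by (intro mult_mono) auto
  also have "1 + s + s * s \<le> 3 * s\<^sup>2"
  proof -
    have "1 * 1 \<le> s * s" "1 * s \<le> s * s"
      using s1 by (intro mult_mono; simp)+
    then show ?thesis
      by (simp add: power2_eq_square)
  qed
  finally have "(1 + (real_of_int m)\<^sup>2) * (1 + (real_of_int n)\<^sup>2) \<le> 3 * s\<^sup>2"
    by simp
  also have "\<dots> \<le> 3 * (C ^ w * N ^ (2 * w))"
    using 1 by simp
  finally have 2: "(1 + (real_of_int m)\<^sup>2) * (1 + (real_of_int n)\<^sup>2) \<le> 3 * C ^ w * N ^ (2 * w)"
    by simp
  have "norm (lattice_term (2 * w) z x) = 1 / N ^ (2 * w)"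
    by (simp add: lattice_term_def mn N_def norm_inverse norm_power divide_inverse)
  also have "\<dots> \<le> 3 * C ^ w / ((1 + (real_of_int m)\<^sup>2) * (1 + (real_of_int n)\<^sup>2))"
    using 2 N by (simp add: field_simps add_pos_nonneg)
  also have "\<dots> = 3 * C ^ w * (\<lambda>(m, n). g m * g n) x"
    by (simp add: mn g_def)
  finally show "norm (lattice_term (2 * w) z x) \<le> 3 * C ^ w * (\<lambda>(m, n). g m * g n) x" .
qed

definition lattice_sum :: "nat \<Rightarrow> complex \<Rightarrow> complex" where
  "lattice_sum k z = infsum (lattice_term k z) (- {(0, 0)})"

lemma has_sum_lattice_sum:
  assumes "Im z > 0" "w \<ge> 2"
  shows "(lattice_term (2 * w) z has_sum lattice_sum (2 * w) z) (- {(0, 0)})"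
  unfolding lattice_sum_def
  by (rule has_sum_infsum[OF Infinite_Sum.abs_summable_summable[OF abs_summable_lattice_term[OF assms]]])

text \<open>Since m (-1/z) + n = (nz - m) / z, inversion merely permutes the lattice points;
  absolute convergence permits the reindexing.\<close>

lemma lattice_sum_inversion:
  assumes z: "Im z > 0" and w: "w \<ge> 2"
  shows "lattice_sum (2 * w) (- 1 / z) = z ^ (2 * w) * lattice_sum (2 * w) z"
proof -
  have "z \<noteq> 0"
    using z by auto
  have "Im (- 1 / z) > 0"
    unfolding Im_minus_inverse using z \<open>z \<noteq> 0\<close> by simp
  then have 1: "(lattice_term (2 * w) (- 1 / z) has_sum lattice_sum (2 * w) (- 1 / z)) (- {(0, 0)})"
    by (rule has_sum_lattice_sum[OF _ w])
  have 2: "((\<lambda>x. z ^ (2 * w) * lattice_term (2 * w) z x) has_sum (z ^ (2 * w) * lattice_sum (2 * w) z)) (- {(0, 0)})"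
    by (rule has_sum_cmult_right[OF has_sum_lattice_sum[OF z w]])
  have eq: "lattice_term (2 * w) (- 1 / z) (m, n) = z ^ (2 * w) * lattice_term (2 * w) z (n, - m)" for m n
  proof -
    have "of_int n * z - of_int m = z * (of_int m * (- 1 / z) + of_int n)"
      using \<open>z \<noteq> 0\<close> by (simp add: field_simps)
    then show ?thesis
      using \<open>z \<noteq> 0\<close> by (simp add: lattice_term_def power_mult_distrib divide_inverse)
  qed
  have "((\<lambda>x. z ^ (2 * w) * lattice_term (2 * w) z x) has_sum (z ^ (2 * w) * lattice_sum (2 * w) z)) (- {(0, 0)})
    \<longleftrightarrow> (lattice_term (2 * w) (- 1 / z) has_sum (z ^ (2 * w) * lattice_sum (2 * w) z)) (- {(0, 0)})"
    by (rule has_sum_reindex_bij_witness[where i = "\<lambda>(m, n). (n, - m)" and j = "\<lambda>(m, n). (- n, m)"])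
       (auto simp: eq[simplified])
  with 2 have "(lattice_term (2 * w) (- 1 / z) has_sum (z ^ (2 * w) * lattice_sum (2 * w) z)) (- {(0, 0)})"
    by simp
  with 1 show ?thesis
    by (rule has_sum_unique)
qed

lemma has_sum_infsum_range:
  assumes "f summable_on range h" "inj h"
  shows "((\<lambda>n. f (h n)) has_sum infsum f (range h)) UNIV"
  using has_sum_infsum[OF assms(1)] has_sum_reindex[OF assms(2), of f] by (simp add: o_def)

lemma lattice_row_has_sum:
  assumes z: "Im z > 0" and w: "w \<ge> 2" and m: "m > 0"
  shows "((\<lambda>n. lattice_term (2 * w) z (m, n)) has_sum
    ((2 * pi * \<i>) ^ (2 * w) / fact (2 * w - 1) *
      (\<Sum>n. of_nat n ^ (2 * w - 1) * (qpar z ^ nat m) ^ n))) UNIV"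
proof -
  define v where "v = of_int m * z"
  have v: "Im v > 0"
    using z m by (simp add: v_def)
  have qv: "qpar v = qpar z ^ nat m"
    using m by (simp add: qpar_def v_def exp_of_nat_mult [symmetric] mult_ac)
  obtain A B where AB:
    "(\<lambda>m. inverse ((v + of_nat m) ^ (2 * w))) sums A"
    "(\<lambda>m. inverse ((1 - v + of_nat m) ^ (2 * w))) sums B"
    "A + B = (2 * pi * \<i>) ^ (2 * w) / fact (2 * w - 1) * (\<Sum>n. of_nat n ^ (2 * w - 1) * qpar v ^ n)"
    using Lipschitz_formula_sums[OF v, of "2 * w"] w by auto
  define f where "f = (\<lambda>n::int. inverse ((v + of_int n) ^ (2 * w)))"
  have f: "f = (\<lambda>n. lattice_term (2 * w) z (m, n))"
    by (simp add: f_def lattice_term_def v_def)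
  have "lattice_term (2 * w) z summable_on (Pair m ` UNIV)"
    by (rule summable_on_subset[OF Infinite_Sum.abs_summable_summable[OF abs_summable_lattice_term[OF z w]]])
       (use m in auto)
  then have sf: "f summable_on UNIV"
    by (subst (asm) summable_on_reindex) (auto simp: o_def f inj_on_def)
  have "f summable_on range int"
    by (rule summable_on_subset[OF sf]) simp
  then have "((\<lambda>n. f (int n)) has_sum infsum f (range int)) UNIV"
    by (rule has_sum_infsum_range) simp
  from has_sum_imp_sums[OF this] AB(1) have A: "infsum f (range int) = A"
    by (intro sums_unique2[of "\<lambda>n. f (int n)"]) (simp_all add: f_def)
  have "f summable_on range (\<lambda>n. - 1 - int n)"
    by (rule summable_on_subset[OF sf]) simp
  then have "((\<lambda>n. f (- 1 - int n)) has_sum infsum f (range (\<lambda>n. - 1 - int n))) UNIV"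
    by (rule has_sum_infsum_range) (simp add: inj_on_def)
  moreover have "f (- 1 - int n) = inverse ((1 - v + of_nat n) ^ (2 * w))" for n
  proof -
    have "v + of_int (- 1 - int n) = - (1 - v + of_nat n)"
      by simp
    then show ?thesis
      by (simp only: f_def power_mult power2_minus)
  qed
  ultimately have "((\<lambda>n. inverse ((1 - v + of_nat n) ^ (2 * w))) has_sum infsum f (range (\<lambda>n. - 1 - int n))) UNIV"
    by simp
  from has_sum_imp_sums[OF this] AB(2) have B: "infsum f (range (\<lambda>n. - 1 - int n)) = B"
    by (rule sums_unique2)
  have "(f has_sum (A + B)) (range int \<union> range (\<lambda>n. - 1 - int n))"
  proof (rule has_sum_Un_disjoint)
    show "(f has_sum A) (range int)"
      unfolding A[symmetric] by (rule has_sum_infsum) fact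
    show "(f has_sum B) (range (\<lambda>n. - 1 - int n))"
      unfolding B[symmetric] by (rule has_sum_infsum) fact
  qed auto
  also have "range int \<union> range (\<lambda>n. - 1 - int n) = UNIV"
  proof -
    have "x \<in> range int \<union> range (\<lambda>n. - 1 - int n)" for x
    proof (cases "x \<ge> 0")
      case True
      then show ?thesis
        by (auto intro: rev_image_eqI[of "nat x"])
    next
      case False
      then have "x = - 1 - int (nat (- 1 - x))"
        by simp
      then show ?thesis
        by blast
    qed
    then show ?thesis
      by blast
  qed
  finally show ?thesis
    unfolding AB(3) qv f .
qed

section \<open>Eisenstein series\<close>

definition divisor_power_sum :: "nat \<Rightarrow> nat \<Rightarrow> nat" where
  "divisor_power_sum s n = (\<Sum>d | d dvd n. d ^ s)"

lemma divisor_power_sum_ge: "n > 0 \<Longrightarrow> n ^ s \<le> divisor_power_sum s n"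
  unfolding divisor_power_sum_def by (rule member_le_sum) auto

lemma divisor_power_sum_le: "n > 0 \<Longrightarrow> divisor_power_sum s n \<le> n ^ Suc s"
proof -
  assume n: "n > 0"
  have "divisor_power_sum s n \<le> card {d. d dvd n} * n ^ s"
    unfolding divisor_power_sum_def
    using sum_bounded_above[of "{d. d dvd n}" "\<lambda>d. d ^ s" "n ^ s"] n
    by (simp add: power_mono dvd_imp_le)
  also have "card {d. d dvd n} \<le> card {1..n}"
    using n by (intro card_mono) (auto simp: dvd_imp_le dvd_pos_nat Suc_le_eq)
  finally show ?thesis
    by simp
qed

lemma summable_norm_of_nat_power_powser:
  fixes v :: complex
  assumes "norm v < 1"
  shows "summable (\<lambda>n. norm (of_nat n ^ j * v ^ n))"
proof -
  obtain r where r: "norm v < r" "r < 1"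
    using assms dense by blast
  then have "norm (complex_of_real r) = r"
    using norm_ge_zero[of v] by (simp del: norm_ge_zero)
  then show ?thesis
    using powser_insidea[OF summable_of_nat_power_powser[of "of_real r" j], of v] r by simp
qed

text \<open>The double series over pairs (m, r) is regrouped by the product n = m r, with d = r as
  the divisor. The bound n^(s+1) for the divisor sum supplies absolute convergence.\<close>

lemma Lambert_series_divisor_power_sum:
  fixes q :: complex
  assumes q: "norm q < 1" and s: "s > 0"
  obtains S where
    "((\<lambda>m. \<Sum>n. of_nat n ^ s * (q ^ m) ^ n) has_sum S) {1..}"
    "((\<lambda>n. of_nat (divisor_power_sum s n) * q ^ n) has_sum S) {1..}"
proof -
  define D where "D = Sigma {1::nat..} (\<lambda>n. {d. d dvd n})"
  define F where "F = (\<lambda>(n, d). of_nat d ^ s * q ^ n)"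
  have fin: "finite {d. d dvd n}" if "n \<in> {1..}" for n :: nat
    using that by simp
  have "(\<lambda>x. norm (F x)) summable_on D"
    unfolding D_def
  proof (rule summable_on_SigmaI)
    show "((\<lambda>d. norm (F (n, d))) has_sum (\<Sum>d | d dvd n. norm (F (n, d)))) {d. d dvd n}"
      if "n \<in> {1..}" for n
      using fin[OF that] by (rule has_sum_finite)
    show "(\<lambda>n. \<Sum>d | d dvd n. norm (F (n, d))) summable_on {1..}"
    proof (rule summable_on_comparison_test)
      show "(\<lambda>n. norm (of_nat n ^ Suc s * q ^ n)) summable_on {1..}"
        by (rule summable_on_subset[OF norm_summable_imp_summable_on])
           (use summable_norm_of_nat_power_powser[OF q, of "Suc s"] in auto)
      fix n :: nat assume n: "n \<in> {1..}"
      have "(\<Sum>d | d dvd n. norm (F (n, d))) = real (divisor_power_sum s n) * norm q ^ n"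
        by (simp add: F_def divisor_power_sum_def norm_mult norm_power sum_distrib_right)
      also have "\<dots> \<le> real (n ^ Suc s) * norm q ^ n"
        using n divisor_power_sum_le[of n s] by (intro mult_right_mono of_nat_mono) auto
      finally show "(\<Sum>d | d dvd n. norm (F (n, d))) \<le> norm (of_nat n ^ Suc s * q ^ n)"
        by (simp add: norm_mult norm_power)
    qed (auto intro: sum_nonneg)
  qed auto
  then have "F summable_on D"
    by (rule Infinite_Sum.abs_summable_summable)
  then obtain S where 1: "(F has_sum S) D"
    using has_sum_infsum by blast
  have "((\<lambda>n. of_nat (divisor_power_sum s n) * q ^ n) has_sum S) {1..}"
  proof (rule has_sum_SigmaD[OF 1[unfolded D_def]])
    show "((\<lambda>d. F (n, d)) has_sum (of_nat (divisor_power_sum s n) * q ^ n)) {d. d dvd n}"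
      if "n \<in> {1..}" for n
      using fin[OF that]
      by (intro has_sum_finiteI) (simp_all add: F_def divisor_power_sum_def sum_distrib_right)
  qed
  moreover have "((\<lambda>m. \<Sum>n. of_nat n ^ s * (q ^ m) ^ n) has_sum S) {1..}"
  proof (rule has_sum_SigmaD)
    have "(F has_sum S) D \<longleftrightarrow>
        ((\<lambda>(m, r). of_nat r ^ s * (q ^ m) ^ r) has_sum S) (Sigma {1..} (\<lambda>_. {1..}))"
      unfolding D_def
      by (rule has_sum_reindex_bij_witness[where i = "\<lambda>(m, r). (m * r, r)" and j = "\<lambda>(n, d). (n div d, d)"])
         (auto simp: F_def dvd_div_eq_0_iff Suc_le_eq dvd_pos_nat simp flip: power_mult)
    with 1 show "((\<lambda>(m, r). of_nat r ^ s * (q ^ m) ^ r) has_sum S) (Sigma {1..} (\<lambda>_. {1..}))"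
      by simp
    fix m :: nat assume m: "m \<in> {1..}"
    then have qm: "norm (q ^ m) < 1"
      using q by (simp add: norm_power power_less_one_iff)
    have "((\<lambda>n. of_nat n ^ s * (q ^ m) ^ n) has_sum (\<Sum>n. of_nat n ^ s * (q ^ m) ^ n)) UNIV"
      using summable_norm_of_nat_power_powser[OF qm] summable_of_nat_power_powser[OF qm]
      by (intro norm_summable_imp_has_sum summable_sums)
    \<comment> \<open>Positivity of s kills the term n = 0, so the index set may shrink.\<close>
    also have "?this \<longleftrightarrow> ((\<lambda>n. (\<lambda>(m, r). of_nat r ^ s * (q ^ m) ^ r) (m, n)) has_sum
        (\<Sum>n. of_nat n ^ s * (q ^ m) ^ n)) {1..}"
      using s by (intro has_sum_cong_neutral) (auto simp: not_le)
    finally show "((\<lambda>n. (\<lambda>(m, r). of_nat r ^ s * (q ^ m) ^ r) (m, n)) has_sum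
        (\<Sum>n. of_nat n ^ s * (q ^ m) ^ n)) {1..}" .
  qed
  ultimately show ?thesis
    using that by blast
qed

section \<open>Even zeta values and the q-expansion of the lattice sum\<close>

definition zeta_even :: "nat \<Rightarrow> real" where
  "zeta_even w = (\<Sum>n. 1 / (real n + 1) ^ (2 * w))"

lemma zeta_even_sums:
  assumes "w > 0"
  shows "(\<lambda>n. 1 / (real n + 1) ^ (2 * w)) sums zeta_even w" and "zeta_even w \<le> pi\<^sup>2 / 6"
    and "zeta_even w > 0"
proof -
  have le: "1 / (real n + 1) ^ (2 * w) \<le> 1 / (real n + 1)\<^sup>2" for n
    using assms by (intro divide_left_mono power_increasing) auto
  have s: "summable (\<lambda>n. 1 / (real n + 1)\<^sup>2)"
    using sums_summable[OF inverse_squares_sums] by (simp add: add.commute)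
  have s': "summable (\<lambda>n. 1 / (real n + 1) ^ (2 * w))"
    by (rule summable_comparison_test'[OF s, of 0]) (use le in auto)
  then show "(\<lambda>n. 1 / (real n + 1) ^ (2 * w)) sums zeta_even w"
    unfolding zeta_even_def by (rule summable_sums)
  show "zeta_even w \<le> pi\<^sup>2 / 6"
    using suminf_le[OF le s' s] inverse_squares_sums by (simp add: zeta_even_def sums_iff add.commute)
  show "zeta_even w > 0"
    unfolding zeta_even_def by (rule suminf_pos[OF s']) (auto intro!: divide_pos_pos zero_less_power add_nonneg_pos)
qed

lemma has_sum_zeta_even:
  assumes "w > 0"
  shows "((\<lambda>n. inverse (of_int n ^ (2 * w) :: complex)) has_sum (2 * of_real (zeta_even w))) (- {0})"
proof -
  let ?f = "\<lambda>n. inverse (of_int n ^ (2 * w) :: complex)"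
  have "((\<lambda>n. 1 / (real n + 1) ^ (2 * w)) has_sum zeta_even w) UNIV"
    using zeta_even_sums(1)[OF assms] by (intro norm_summable_imp_has_sum) (auto simp: sums_iff)
  then have h: "((\<lambda>n. complex_of_real (1 / (real n + 1) ^ (2 * w))) has_sum of_real (zeta_even w)) UNIV"
    by (rule has_sum_of_real)
  have 1: "(?f has_sum of_real (zeta_even w)) (range (\<lambda>n. 1 + int n))"
    by (subst has_sum_reindex) (use h in \<open>auto simp: o_def inj_on_def divide_inverse add_ac\<close>)
  have *: "of_int (- 1 - int n) ^ (2 * w) = (1 + of_nat n :: complex) ^ (2 * w)" for n
  proof -
    have "of_int (- 1 - int n) = - (1 + of_nat n :: complex)"
      by simp
    then show ?thesis
      by (simp only: power_mult power2_minus)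
  qed
  have 2: "(?f has_sum of_real (zeta_even w)) (range (\<lambda>n. - 1 - int n))"
    by (subst has_sum_reindex) (use h in \<open>auto simp: o_def inj_on_def divide_inverse add_ac * simp del: of_int_diff\<close>)
  have "(?f has_sum (of_real (zeta_even w) + of_real (zeta_even w)))
      (range (\<lambda>n. 1 + int n) \<union> range (\<lambda>n. - 1 - int n))"
    by (rule has_sum_Un_disjoint[OF 1 2]) auto
  also have "range (\<lambda>n. 1 + int n) \<union> range (\<lambda>n. - 1 - int n) = - {0}"
  proof -
    have "x \<in> range (\<lambda>n. 1 + int n) \<union> range (\<lambda>n. - 1 - int n)" if "x \<noteq> 0" for x
    proof (cases "x \<ge> 0")
      case True
      then have "x = 1 + int (nat (x - 1))"
        using that by simp
      then show ?thesis
        by blast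
    next
      case False
      then have "x = - 1 - int (nat (- 1 - x))"
        by simp
      then show ?thesis
        by blast
    qed
    moreover have "1 + int n \<noteq> 0" "- 1 - int n \<noteq> 0" for n
      by auto
    ultimately show ?thesis
      by (auto simp del: of_int_diff)
  qed
  finally show ?thesis
    by simp
qed

text \<open>The row m = 0 gives the zeta value. Each row m > 0 is a Lipschitz sum at mz, and
  together they form a Lambert series; the rows m < 0 repeat them by the symmetry (m, n) to (-m,
  -n).\<close>

lemma lattice_sum_qpar:
  assumes z: "Im z > 0" and w: "w \<ge> 2"
  obtains S where
    "((\<lambda>n. of_nat (divisor_power_sum (2 * w - 1) n) * qpar z ^ n) has_sum S) {1..}"
    "lattice_sum (2 * w) z = 2 * of_real (zeta_even w) + 2 * ((2 * pi * \<i>) ^ (2 * w) / fact (2 * w - 1)) * S"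
proof -
  define c where "c = (2 * pi * \<i>) ^ (2 * w) / fact (2 * w - 1)"
  have q: "norm (qpar z) < 1"
    using z by (simp add: norm_qpar qmod_less_1)
  have "2 * w - 1 > 0"
    using w by simp
  then obtain S where S:
    "((\<lambda>m. \<Sum>n. of_nat n ^ (2 * w - 1) * (qpar z ^ m) ^ n) has_sum S) {1..}"
    "((\<lambda>n. of_nat (divisor_power_sum (2 * w - 1) n) * qpar z ^ n) has_sum S) {1..}"
    using Lambert_series_divisor_power_sum[OF q] by blast
  let ?L = "lattice_term (2 * w) z"
  define A0 Ap An :: "(int \<times> int) set" where "A0 = Pair 0 ` (- {0})"
    and "Ap = Sigma {1..} (\<lambda>_. UNIV)" and "An = Sigma {..-1} (\<lambda>_. UNIV)"
  have "?L summable_on Ap"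
    by (rule summable_on_subset[OF Infinite_Sum.abs_summable_summable[OF abs_summable_lattice_term[OF z w]]])
       (auto simp: Ap_def)
  then obtain T where p: "(?L has_sum T) Ap"
    using has_sum_infsum by blast
  have "((\<lambda>m. c * (\<Sum>n. of_nat n ^ (2 * w - 1) * (qpar z ^ nat m) ^ n)) has_sum T) {1..}"
    unfolding c_def
    by (rule has_sum_SigmaD[OF p[unfolded Ap_def]])
       (use lattice_row_has_sum[OF z w] in auto)
  also have "?this \<longleftrightarrow> ((\<lambda>m. c * (\<Sum>n. of_nat n ^ (2 * w - 1) * (qpar z ^ m) ^ n)) has_sum T) {1..}"
    by (rule has_sum_reindex_bij_witness[where i = int and j = nat]) auto
  finally have "T = c * S"
    using has_sum_cmult_right[OF S(1), of c] has_sum_unique by blast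
  with p have p: "(?L has_sum c * S) Ap"
    by simp
  have eq: "?L (- m, - n) = ?L (m, n)" for m n
  proof -
    have "of_int (- m) * z + of_int (- n) = - (of_int m * z + of_int n)"
      by simp
    then show ?thesis
      by (simp only: lattice_term_def prod.case power_mult power2_minus)
  qed
  have "(?L has_sum c * S) Ap \<longleftrightarrow> (?L has_sum c * S) An"
    by (rule has_sum_reindex_bij_witness[where i = "\<lambda>(m, n). (- m, - n)" and j = "\<lambda>(m, n). (- m, - n)"])
       (auto simp: Ap_def An_def eq)
  with p have n: "(?L has_sum c * S) An"
    by simp
  have "(?L has_sum 2 * of_real (zeta_even w)) A0"
    unfolding A0_def using has_sum_zeta_even[of w] w
    by (subst has_sum_reindex) (auto simp: o_def lattice_term_def inj_on_def)
  then have "(?L has_sum (2 * of_real (zeta_even w) + (c * S + c * S))) (A0 \<union> (Ap \<union> An))"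
    by (intro has_sum_Un_disjoint p n) (auto simp: A0_def Ap_def An_def)
  also have "A0 \<union> (Ap \<union> An) = - {(0, 0)}"
    by (auto simp: A0_def Ap_def An_def image_iff)
  finally have "lattice_sum (2 * w) z = 2 * of_real (zeta_even w) + (c * S + c * S)"
    using has_sum_lattice_sum[OF z w] has_sum_unique by blast
  with S(2) show ?thesis
    by (intro that[of S]) (simp_all add: c_def)
qed

text \<open>Yields translation invariance of the Eisenstein series from its expansion, with no
  second reindexing of the lattice sum.\<close>

lemma fourier_coeffs_periodic:
  assumes "fourier_coeffs f c" "Im z > 0"
  shows "f (z + 1) = f z"
  using fourier_coeffs_sums[OF assms] fourier_coeffs_sums[OF assms(1), of "z + 1"] assms(2)
  by (simp add: qpar_add_1 sums_unique2)

text \<open>The lower bound keeps only the divisor d = n in the divisor sum and replaces zeta(2w) by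
  the larger zeta(2), whence the factor 6 / pi^2.\<close>

theorem Eisenstein_series:
  assumes w: "even w" "w \<ge> 2"
  obtains E and e :: "nat \<Rightarrow> real" where
    "fourier_coeffs E (\<lambda>n. of_real (e n))" "weakly_modular (2 * w) E" "e 0 = 1"
    "\<And>n. n > 0 \<Longrightarrow> 6 / pi\<^sup>2 * (2 * pi) ^ (2 * w) / fact (2 * w - 1) * real n ^ (2 * w - 1) \<le> e n"
proof -
  define C where "C = (2 * pi) ^ (2 * w) / fact (2 * w - 1) / zeta_even w"
  have zeta: "zeta_even w > 0" "zeta_even w \<le> pi\<^sup>2 / 6"
    using zeta_even_sums[of w] w by auto
  define e where "e n = (if n = 0 then 1 else C * real (divisor_power_sum (2 * w - 1) n))" for n
  define E where "E z = lattice_sum (2 * w) z / (2 * of_real (zeta_even w))" for z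
  have fE: "fourier_coeffs E (\<lambda>n. of_real (e n))"
    unfolding fourier_coeffs_def
  proof
    fix z assume "z \<in> upper_half_plane"
    then have z: "Im z > 0"
      by simp
    obtain S where S:
      "((\<lambda>n. of_nat (divisor_power_sum (2 * w - 1) n) * qpar z ^ n) has_sum S) {1..}"
      "lattice_sum (2 * w) z = 2 * of_real (zeta_even w) + 2 * ((2 * pi * \<i>) ^ (2 * w) / fact (2 * w - 1)) * S"
      using lattice_sum_qpar[OF z w(2)] by blast
    \<comment> \<open>For even w the power of i is 1; this is what makes all coefficients
      positive.\<close>
    have "(2 * pi * \<i>) ^ (2 * w) = of_real ((2 * pi) ^ (2 * w))"
      using w by (simp add: power_mult_distrib power_mult)
    then have "E z = 1 + of_real C * S"
      using zeta unfolding E_def S(2) by (simp add: C_def add_divide_distrib)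
    have "((\<lambda>n. of_real C * (of_nat (divisor_power_sum (2 * w - 1) n) * qpar z ^ n)) has_sum of_real C * S) {1..}"
      by (rule has_sum_cmult_right[OF S(1)])
    also have "?this \<longleftrightarrow> ((\<lambda>n. of_real (e n) * qpar z ^ n) has_sum of_real C * S) {1..}"
      by (rule has_sum_cong) (auto simp: e_def)
    finally have "((\<lambda>n. of_real (e n) * qpar z ^ n) has_sum (1 + of_real C * S)) ({0} \<union> {1..})"
      by (intro has_sum_Un_disjoint) (auto simp: e_def intro!: has_sum_finiteI)
    also have "{0::nat} \<union> {1..} = UNIV"
      by auto
    finally show "(\<lambda>n. of_real (e n) * qpar z ^ n) sums E z"
      unfolding \<open>E z = 1 + of_real C * S\<close> by (rule has_sum_imp_sums)
  qed
  moreover have "weakly_modular (2 * w) E"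
    unfolding weakly_modular_def
    using fourier_coeffs_periodic[OF fE] lattice_sum_inversion[OF _ w(2)] by (simp add: E_def)
  moreover have "6 / pi\<^sup>2 * (2 * pi) ^ (2 * w) / fact (2 * w - 1) * real n ^ (2 * w - 1) \<le> e n" if "n > 0" for n
  proof -
    have "6 / pi\<^sup>2 \<le> 1 / zeta_even w"
      using zeta by (simp add: field_simps)
    then have "(2 * pi) ^ (2 * w) / fact (2 * w - 1) * (6 / pi\<^sup>2) \<le> (2 * pi) ^ (2 * w) / fact (2 * w - 1) * (1 / zeta_even w)"
      by (intro mult_left_mono) auto
    then have "6 / pi\<^sup>2 * (2 * pi) ^ (2 * w) / fact (2 * w - 1) \<le> C"
      by (simp add: C_def mult_ac)
    moreover have "real n ^ (2 * w - 1) \<le> real (divisor_power_sum (2 * w - 1) n)"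
      using divisor_power_sum_ge[OF that, of "2 * w - 1"] by (metis of_nat_le_iff of_nat_power)
    ultimately have "6 / pi\<^sup>2 * (2 * pi) ^ (2 * w) / fact (2 * w - 1) * real n ^ (2 * w - 1) \<le>
        C * real (divisor_power_sum (2 * w - 1) n)"
      using zeta by (intro mult_mono) (auto simp: C_def)
    then show ?thesis
      using that by (simp add: e_def)
  qed
  ultimately show ?thesis
    by (intro that[of E e]) (auto simp: e_def)
qed

section \<open>Bounding the cusp form by initial nonnegativity\<close>

text \<open>The map is the composite of an inversion, a translation by -N and another inversion, so
  the two generators suffice.\<close>

lemma weakly_modular_lower_triangular:
  assumes f: "weakly_modular (2 * w) f" and z: "Im z > 0"
  shows "f (z / (1 + of_nat N * z)) = (1 + of_nat N * z) ^ (2 * w) * f z"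
proof -
  have z0: "z \<noteq> 0"
    using z by auto
  have shift: "f (u - of_nat N) = f u" if u: "Im u > 0" for u
  proof (induction N)
    case (Suc N)
    have "Im (u - of_nat (Suc N)) > 0"
      using u by simp
    then have "f (u - of_nat (Suc N) + 1) = f (u - of_nat (Suc N))"
      using f unfolding weakly_modular_def by blast
    also have "u - of_nat (Suc N) + 1 = u - of_nat N"
      by simp
    finally show ?case
      using Suc.IH by simp
  qed simp
  define u where "u = - 1 / z - of_nat N"
  have Im1: "Im (- 1 / z) > 0"
    unfolding Im_minus_inverse using z z0 by simp
  then have Im2: "Im u > 0"
    by (simp add: u_def)
  have u: "u = - (1 + of_nat N * z) / z"
    using z0 by (simp add: u_def field_simps)
  have "u \<noteq> 0"
    using Im2 by auto
  then have "1 + of_nat N * z \<noteq> 0"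
    unfolding u by force
  then have "z / (1 + of_nat N * z) = - 1 / u"
  proof -
    have "z / D = - 1 / (- D / z)" for D
      by simp
    then show ?thesis
      unfolding u .
  qed
  also have "f \<dots> = u ^ (2 * w) * f u"
    using f Im2 unfolding weakly_modular_def by blast
  also have "f u = f (- 1 / z)"
    unfolding u_def using Im1 by (rule shift)
  also have "f (- 1 / z) = z ^ (2 * w) * f z"
    using f z unfolding weakly_modular_def by blast
  also have "u ^ (2 * w) * (z ^ (2 * w) * f z) = (u * z) ^ (2 * w) * f z"
    by (simp add: power_mult_distrib)
  also have "u * z = - (1 + of_nat N * z)"
    using z0 by (simp add: u)
  also have "(- (1 + of_nat N * z)) ^ (2 * w) = (1 + of_nat N * z) ^ (2 * w)"
    by (simp only: power_mult power2_minus)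
  finally show ?thesis .
qed

text \<open>The value is exp (8 pi / 5), about 152.4; the slack 1/37 in the exponent just covers 8
  pi / 5 - 5.\<close>

lemma inverse_qmod_le: "1 / qmod (4/5) \<le> 153"
proof -
  have e: "exp 1 \<le> (27183 / 10000 :: real)"
    using e_approx_32 by (simp add: abs_if split: if_split_asm)
  have "8 * pi / 5 \<le> (5 + 1/37 :: real)"
    using pi_approx by simp
  then have "exp (8 * pi / 5) \<le> exp (5 + 1/37 :: real)"
    by simp
  also have "\<dots> = exp 1 ^ 5 * exp (1/37)"
    by (simp only: exp_add exp_of_nat_mult [symmetric]) simp
  also have "\<dots> \<le> (27183 / 10000) ^ 5 * (37 / 36)"
  proof (intro mult_mono power_mono e)
    have "36 / 37 \<le> exp (- (1/37) :: real)"
      using exp_ge_add_one_self[of "- (1/37)"] by simp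
    then show "exp (1/37) \<le> (37/36 :: real)"
      by (simp add: exp_minus field_simps)
  qed auto
  also have "\<dots> \<le> 153"
    by (simp add: power_divide)
  also have "exp (8 * pi / 5) = 1 / qmod (4/5)"
  proof -
    have "- (2 * pi * (4/5)) = - (8 * pi / 5)"
      by simp
    then show ?thesis
      by (simp only: qmod_def exp_minus divide_inverse inverse_inverse_eq mult_1)
  qed
  finally show ?thesis .
qed

text \<open>Here R is (Y / y0)^w for y0 = 4/5. The exponent w + 4 in the tail condition leaves
  n^(-4) after Hecke's n^w: two powers sum the series and two give the gain X^(-2).\<close>

lemma coeff_le_of_initial_nonneg:
  fixes a e :: "nat \<Rightarrow> real"
  assumes f: "fourier_coeffs f (\<lambda>n. of_real (a n))" "weakly_modular (2 * w) f" "a 0 = 1"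
    and E: "fourier_coeffs E (\<lambda>n. of_real (e n))" "weakly_modular (2 * w) E" "e 0 = 1"
    and e: "\<And>n. e n \<ge> 0" and a: "\<And>n. n > 0 \<Longrightarrow> real n \<le> X \<Longrightarrow> a n \<ge> 0"
    and w: "w > 0" and N: "N > 0" and X: "X \<ge> 100"
  defines "R \<equiv> (real N ^ 2 + 25/16) ^ w" and "Y \<equiv> real N ^ 2 * (4/5) + 5/4"
  assumes R: "R * qmod (Y - 4/5) \<le> 1/8"
    and tail: "\<And>n. real n > X \<Longrightarrow> real n ^ (w + 4) * qmod (1 / Y) ^ n \<le> 1"
    and n: "n > 0"
  shows "\<bar>a n - e n\<bar> \<le> 8/3 * R / qmod (4/5) * real n ^ w"
proof -
  define c where "c n = a n - e n" for n
  define b where "b n = a n + e n" for n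
  define t where "t n = (if real n > X then \<bar>c n\<bar> else 0)" for n
  \<comment> \<open>A nonnegative majorant of both |b| and |c| away from n = 0. Up to X it is b
    itself. Beyond X nothing is known of the sign of b, but b = c + 2e with e \<ge> 0, so adding
    2|c| suffices. The value 0 at n = 0 separates the constant term 2 of h and lets the decay
    estimate apply.\<close>
  define p where "p n = (if n = 0 then 0 else b n + 2 * t n)" for n
  define h where "h z = f z + E z" for z
  have t0: "t n \<ge> 0" for n
    by (simp add: t_def)
  have pc: "\<bar>c n\<bar> \<le> p n" for n
    using e[of n] a[of n] f(3) E(3) by (auto simp: p_def b_def c_def t_def)
  have pb: "\<bar>b n\<bar> \<le> p n" if "n > 0" for n
  proof (cases "real n > X")
    case True
    have "\<bar>a n + e n\<bar> \<le> a n + e n + 2 * \<bar>a n - e n\<bar>"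
      using e[of n] by (simp add: abs_if)
    with True that show ?thesis
      by (simp add: p_def b_def c_def t_def)
  next
    case False
    with e[of n] a[of n] that show ?thesis
      by (simp add: p_def b_def t_def)
  qed
  have p0: "p n \<ge> 0" for n
    using pc[of n] by linarith
  have fc: "fourier_coeffs (\<lambda>z. f z - E z) (\<lambda>n. of_real (c n))"
    using fourier_coeffs_diff[OF f(1) E(1)] by (simp add: c_def)
  have mc: "weakly_modular (2 * w) (\<lambda>z. f z - E z)"
    by (rule weakly_modular_diff[OF f(2) E(2)])
  have fh: "fourier_coeffs h (\<lambda>n. of_real (b n))"
    using fourier_coeffs_add[OF f(1) E(1)] by (simp add: b_def h_def [abs_def])
  have mh: "weakly_modular (2 * w) h"
    using weakly_modular_add[OF f(2) E(2)] by (simp add: h_def [abs_def])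
  have sc: "summable (\<lambda>n. \<bar>c n\<bar> * qmod y ^ n)" and sb: "summable (\<lambda>n. \<bar>b n\<bar> * qmod y ^ n)" if "y > 0" for y
    using fourier_coeffs_summable_qmod[OF fc that] fourier_coeffs_summable_qmod[OF fh that] by simp_all
  have st: "summable (\<lambda>n. t n * qmod y ^ n)" if "y > 0" for y
    by (rule summable_comparison_test'[OF sc[OF that], of 0]) (simp add: t_def abs_mult)
  have sp: "summable (\<lambda>n. p n * qmod y ^ n)" if "y > 0" for y
  proof (rule summable_comparison_test')
    show "summable (\<lambda>n. \<bar>b n\<bar> * qmod y ^ n + 2 * (t n * qmod y ^ n))"
      using that by (intro summable_add summable_mult sb st)
    show "norm (p n * qmod y ^ n) \<le> \<bar>b n\<bar> * qmod y ^ n + 2 * (t n * qmod y ^ n)" for n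
    proof -
      have "p n \<le> \<bar>b n\<bar> + 2 * t n"
        using t0[of n] by (auto simp: p_def)
      then have "p n * qmod y ^ n \<le> (\<bar>b n\<bar> + 2 * t n) * qmod y ^ n"
        by (intro mult_right_mono) auto
      then show ?thesis
        using p0[of n] by (simp add: abs_mult algebra_simps)
    qed
  qed
  define P where "P y = (\<Sum>n. p n * qmod y ^ n)" for y
  define T where "T y = (\<Sum>n. t n * qmod y ^ n)" for y
  have P0: "P y \<ge> 0" and T0: "T y \<ge> 0" if "y > 0" for y
    unfolding P_def T_def using that p0 t0 by (auto intro!: suminf_nonneg sp st)
  have h_im: "h (\<i> * of_real y) = of_real (2 + P y - 2 * T y)" if y: "y > 0" for y
  proof -
    have "(\<lambda>n. (if n = 0 then 2 else 0) + p n * qmod y ^ n - 2 * (t n * qmod y ^ n)) sums (2 + P y - 2 * T y)"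
      unfolding P_def T_def using y
      by (intro sums_diff sums_add sums_mult summable_sums sp st sums_single[of 0 "\<lambda>_. 2", simplified])
    then have "(\<lambda>n. complex_of_real ((if n = 0 then 2 else 0) + p n * qmod y ^ n - 2 * (t n * qmod y ^ n)))
        sums of_real (2 + P y - 2 * T y)"
      by (rule sums_of_real)
    moreover have "(if n = 0 then 2 else 0) + p n * qmod y ^ n - 2 * (t n * qmod y ^ n) = b n * qmod y ^ n" for n
      using f(3) E(3) by (auto simp: p_def b_def c_def t_def algebra_simps)
    ultimately have "(\<lambda>n. of_real (b n) * qpar (\<i> * of_real y) ^ n) sums of_real (2 + P y - 2 * T y)"
      by (simp add: qpar_imaginary)
    moreover have "(\<lambda>n. of_real (b n) * qpar (\<i> * of_real y) ^ n) sums h (\<i> * of_real y)"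
      by (rule fourier_coeffs_sums[OF fh]) (use y in simp)
    ultimately show ?thesis
      by (rule sums_unique2[symmetric])
  qed
  have h_le: "norm (h z) \<le> 2 + P (Im z)" if z: "Im z > 0" for z
  proof -
    have "norm (h z) \<le> (\<Sum>n. \<bar>b n\<bar> * qmod (Im z) ^ n)"
      using fourier_norm_le[OF fh z] by simp
    also have "\<dots> \<le> (\<Sum>n. (if n = 0 then 2 else 0) + p n * qmod (Im z) ^ n)"
    proof (rule suminf_le)
      show "\<bar>b n\<bar> * qmod (Im z) ^ n \<le> (if n = 0 then 2 else 0) + p n * qmod (Im z) ^ n" for n
        using pb[of n] f(3) E(3) by (cases "n = 0") (auto simp: b_def p_def intro!: mult_right_mono)
      show "summable (\<lambda>n. (if n = 0 then 2 else 0) + p n * qmod (Im z) ^ n)"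
        using sums_summable[OF sums_single[of 0 "\<lambda>_. 2::real"]]
        by (intro summable_add sp z) simp
    qed (rule sb[OF z])
    also have "\<dots> = 2 + P (Im z)"
      unfolding P_def using z
      by (intro sums_unique[symmetric] sums_add summable_sums sp sums_single[of 0 "\<lambda>_. 2", simplified])
    finally show ?thesis .
  qed
  have Y: "Y \<ge> 2"
  proof -
    have "1\<^sup>2 \<le> (real N)\<^sup>2"
      using N by (intro power_mono) auto
    then show ?thesis
      by (simp add: Y_def)
  qed
  define z0 where "z0 = \<i> * complex_of_real (4/5)"
  define u where "u = z0 / (1 + of_nat N * z0)"
  have nrm: "(norm (1 + of_nat N * z0))\<^sup>2 = 4/5 * Y"
    unfolding cmod_power2 by (simp add: z0_def Y_def power2_eq_square)
  have Im_u: "Im u = 1 / Y"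
  proof -
    have "Im u = (4/5) / (norm (1 + of_nat N * z0))\<^sup>2"
      unfolding u_def Im_divide cmod_power2 by (simp add: z0_def)
    then show ?thesis
      unfolding nrm by simp
  qed
  have "h u = (1 + of_nat N * z0) ^ (2 * w) * h z0"
    unfolding u_def by (rule weakly_modular_lower_triangular[OF mh]) (simp add: z0_def)
  then have 1: "norm (h u) = (4/5 * Y) ^ w * norm (h z0)"
    by (simp add: norm_mult norm_power power_mult nrm)
  \<comment> \<open>The point u lies at height 1/Y, where |h| is at most the majorant; up to the
    tail T the majorant is the value of h itself on the imaginary axis.\<close>
  have "norm (h u) \<le> 2 + P (1 / Y)"
    using h_le[of u] Im_u Y by simp
  also have "\<dots> \<le> norm (h (\<i> * of_real (1 / Y))) + 2 * T (1 / Y)"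
    using h_im[of "1 / Y"] Y by (simp add: norm_of_real del: of_real_add of_real_diff of_real_divide)
  also have "\<i> * complex_of_real (1 / Y) = - 1 / (\<i> * of_real Y)"
    using Y by (simp add: field_simps)
  also have "h \<dots> = (\<i> * of_real Y) ^ (2 * w) * h (\<i> * of_real Y)"
    using mh Y unfolding weakly_modular_def by simp
  also have "norm \<dots> = Y ^ (2 * w) * norm (h (\<i> * of_real Y))"
    using Y by (simp add: norm_mult norm_power)
  also have "Y ^ (2 * w) * norm (h (\<i> * of_real Y)) + 2 * T (1 / Y) \<le> Y ^ (2 * w) * (2 + P Y) + 2 * T (1 / Y)"
    using h_le[of "\<i> * of_real Y"] Y by (intro add_right_mono mult_left_mono) auto
  also have "Y ^ (2 * w) = (4/5 * Y) ^ w * R"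
  proof -
    have "R = (5/4 * Y) ^ w"
      unfolding R_def Y_def by (simp add: algebra_simps)
    then show ?thesis
      by (simp add: power_mult_distrib [symmetric] power_mult power2_eq_square)
  qed
  \<comment> \<open>Inserting this factor, which is at least 1, allows it to be cancelled from the
    whole inequality.\<close>
  also have "2 * T (1 / Y) \<le> (4/5 * Y) ^ w * (2 * T (1 / Y))"
    using Y T0[of "1 / Y"] mult_right_mono[OF one_le_power[of "4/5 * Y" w], of "2 * T (1 / Y)"] by simp
  finally have "(4/5 * Y) ^ w * norm (h z0) \<le> (4/5 * Y) ^ w * (R * (2 + P Y) + 2 * T (1 / Y))"
    by (simp add: 1 algebra_simps)
  then have "norm (h z0) \<le> R * (2 + P Y) + 2 * T (1 / Y)"
    using Y by (simp add: mult_le_cancel_left_pos)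
  moreover have "2 + P (4/5) - 2 * T (4/5) \<le> norm (h z0)"
    unfolding z0_def h_im[of "4/5", simplified] h_im[OF zero_less_divide_iff[THEN iffD2]]
    using h_im[of "4/5"] by (simp add: norm_of_real del: of_real_add of_real_diff of_real_divide)
  moreover have "T (4/5) \<le> T (1 / Y)"
    unfolding T_def
  proof (rule suminf_le)
    fix n
    have "qmod (4/5) \<le> qmod (1 / Y)"
      using Y by (intro qmod_mono) (simp add: field_simps)
    then show "t n * qmod (4/5) ^ n \<le> t n * qmod (1 / Y) ^ n"
      using t0[of n] by (intro mult_left_mono power_mono) auto
  qed (use Y in \<open>auto intro!: st\<close>)
  \<comment> \<open>First absorption: P has no constant term, so between heights 4/5 and Y it decays
    enough to offset R.\<close>
  moreover have "R * (2 + P Y) \<le> 2 * R + 1/8 * P (4/5)"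
  proof -
    have "P Y \<le> qmod (Y - 4/5) * P (4/5)"
      unfolding P_def using Y p0 by (intro qmod_series_decay(2) sp) (auto simp: p_def)
    then have "R * P Y \<le> R * (qmod (Y - 4/5) * P (4/5))"
      by (intro mult_left_mono) (auto simp: R_def intro!: zero_le_power add_nonneg_nonneg)
    also have "\<dots> = (R * qmod (Y - 4/5)) * P (4/5)"
      by simp
    also have "\<dots> \<le> 1/8 * P (4/5)"
      using R P0[of "4/5"] by (intro mult_right_mono) auto
    finally show ?thesis
      by (simp add: algebra_simps)
  qed
  moreover have A: "\<bar>c n\<bar> \<le> P (4/5) / qmod (4/5) * real n ^ w" if n: "n > 0" for n
  proof -
    have "\<bar>c n\<bar> \<le> (\<Sum>m. \<bar>c m\<bar> * qmod (4/5) ^ m) / qmod (4/5) * real n ^ w"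
      using cusp_form_coeff_le[OF fc mc _ w n] f(3) E(3) by (simp add: c_def del: of_real_diff)
    also have "\<dots> \<le> P (4/5) / qmod (4/5) * real n ^ w"
      unfolding P_def
      by (intro mult_right_mono divide_right_mono suminf_le sc sp pc) auto
    finally show ?thesis .
  qed
  \<comment> \<open>Second absorption: Hecke's bound makes the tail a multiple of P (4/5). The
    multiple is at most 4 * 2 * 153 / 100^2 = 0.1224, which is below 1/8.\<close>
  moreover have "4 * T (1 / Y) \<le> 1/8 * P (4/5)"
  proof -
    define K where "K = P (4/5) / qmod (4/5) * (1 / X\<^sup>2)"
    have K: "K \<ge> 0"
      using P0[of "4/5"] by (simp add: K_def)
    have le: "t (Suc n) * qmod (1 / Y) ^ Suc n \<le> K * (1 / (real n + 1)\<^sup>2)" for n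
    proof (cases "real (Suc n) > X")
      case True
      define m where "m = real (Suc n)"
      have m: "m > X" "m > 0"
        using True by (simp_all add: m_def)
      have "X\<^sup>2 \<le> m\<^sup>2"
        using m X by (intro power_mono) auto
      then have "X\<^sup>2 * m\<^sup>2 \<le> m\<^sup>2 * m\<^sup>2"
        by (intro mult_right_mono) auto
      have "m ^ w * qmod (1 / Y) ^ Suc n * m ^ 4 \<le> 1"
        using tail[OF True] by (simp add: m_def power_add mult_ac)
      then have "m ^ w * qmod (1 / Y) ^ Suc n \<le> 1 / (m\<^sup>2 * m\<^sup>2)"
        using m by (simp add: field_simps power2_eq_square power4_eq_xxxx)
      also have "\<dots> \<le> 1 / (X\<^sup>2 * m\<^sup>2)"
        using \<open>X\<^sup>2 * m\<^sup>2 \<le> m\<^sup>2 * m\<^sup>2\<close> X m by (intro divide_left_mono) auto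
      finally have 2: "m ^ w * qmod (1 / Y) ^ Suc n \<le> 1 / (X\<^sup>2 * m\<^sup>2)" .
      have "t (Suc n) * qmod (1 / Y) ^ Suc n \<le> P (4/5) / qmod (4/5) * m ^ w * qmod (1 / Y) ^ Suc n"
        using A[of "Suc n"] True by (intro mult_right_mono) (auto simp: t_def m_def)
      also have "\<dots> = P (4/5) / qmod (4/5) * (m ^ w * qmod (1 / Y) ^ Suc n)"
        by simp
      also have "\<dots> \<le> P (4/5) / qmod (4/5) * (1 / (X\<^sup>2 * m\<^sup>2))"
        using P0[of "4/5"] by (intro mult_left_mono 2) auto
      also have "\<dots> = K * (1 / (real n + 1)\<^sup>2)"
        by (simp add: K_def m_def add.commute)
      finally show ?thesis .
    qed (use K in \<open>simp add: t_def\<close>)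
    have "T (1 / Y) = (\<Sum>n. t (Suc n) * qmod (1 / Y) ^ Suc n)"
      unfolding T_def using suminf_split_head[OF st[of "1 / Y"]] Y f(3) E(3) by (simp add: t_def c_def)
    also have "\<dots> \<le> (\<Sum>n. K * (1 / (real n + 1)\<^sup>2))"
    proof (rule suminf_le[OF le])
      show "summable (\<lambda>n. t (Suc n) * qmod (1 / Y) ^ Suc n)"
        using st[of "1 / Y"] Y by (subst summable_Suc_iff) simp
      show "summable (\<lambda>n. K * (1 / (real n + 1)\<^sup>2))"
        using sums_summable[OF inverse_squares_sums] by (intro summable_mult) (simp add: add.commute)
    qed
    also have "\<dots> = K * (pi\<^sup>2 / 6)"
      using sums_unique[OF sums_mult[OF inverse_squares_sums, of K]] by (simp add: add.commute)
    also have "\<dots> \<le> K * 2"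
    proof (rule mult_left_mono[OF _ K])
      have "pi * pi \<le> 3.2 * 3.2"
        using pi_approx by (intro mult_mono) auto
      then show "pi\<^sup>2 / 6 \<le> 2"
        by (simp add: power2_eq_square)
    qed
    also have "K = P (4/5) * (1 / qmod (4/5)) * (1 / X\<^sup>2)"
      by (simp add: K_def)
    also have "\<dots> \<le> P (4/5) * 153 * (1 / 100\<^sup>2)"
      using P0[of "4/5"] X inverse_qmod_le power_mono[OF X, of 2]
      by (intro mult_mono divide_left_mono) auto
    finally show ?thesis
      using P0[of "4/5"] by simp
  qed
  \<comment> \<open>Collected, the estimates give P \<le> 2R + P/8 + P/8, hence the factor
    8/3.\<close>
  ultimately have "P (4/5) \<le> 8/3 * R"
    using P0[of "4/5"] by linarith
  then have "P (4/5) / qmod (4/5) * real n ^ w \<le> 8/3 * R / qmod (4/5) * real n ^ w"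
    by (intro mult_right_mono divide_right_mono) auto
  then show ?thesis
    using A[OF n] by (simp add: c_def)
qed

section \<open>Explicit estimates\<close>

lemma exp_1_le: "exp 1 \<le> (27183 / 10000 :: real)" and exp_1_ge: "27182 / 10000 \<le> (exp 1 :: real)"
  using e_approx_32 by (simp_all add: abs_if split: if_split_asm)

lemma exp_le_inverse_power:
  fixes x :: real
  assumes "x < real n" "n > 0"
  shows "exp x \<le> (1 / (1 - x / real n)) ^ n"
proof -
  have "1 - x / n \<le> exp (- (x / n))"
    using exp_ge_add_one_self[of "- (x / n)"] by simp
  moreover have "1 - x / n > 0"
    using assms by (simp add: field_simps)
  ultimately have "exp (x / n) \<le> 1 / (1 - x / n)"
    by (simp add: exp_minus field_simps)
  then have "exp (x / n) ^ n \<le> (1 / (1 - x / n)) ^ n"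
    by (intro power_mono) auto
  then show ?thesis
    using assms by (simp add: exp_of_nat_mult [symmetric])
qed

text \<open>A Stirling bound without square root: the quotient of the two sides behaves like sqrt (2
  pi / m). The induction step is (1 + 1/m)^(m+1) \<ge> e.\<close>

lemma fact_exp_le:
  assumes "m \<ge> 12"
  shows "fact (m - 1) * exp 1 ^ m \<le> real m ^ m"
  using assms
proof (induction m rule: dec_induct)
  case base
  have "exp 1 ^ 12 \<le> (27183 / 10000 :: real) ^ 12"
    by (intro power_mono exp_1_le) auto
  also have "39916800 * \<dots> \<le> 12 ^ 12"
    by (simp add: power_divide)
  finally show ?case
    by (simp add: fact_numeral)
next
  case (step m)
  then have m: "m \<ge> 12"
    by simp
  have "1 - 1 / (real m + 1) \<le> exp (- (1 / (real m + 1)))"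
    using exp_ge_add_one_self[of "- (1 / (real m + 1))"] by simp
  then have "(1 - 1 / (real m + 1)) ^ Suc m \<le> exp (- (1 / (real m + 1))) ^ Suc m"
    using m by (intro power_mono) auto
  also have "\<dots> = exp (real (Suc m) * - (1 / (real m + 1)))"
    by (rule exp_of_nat_mult [symmetric])
  also have "real (Suc m) * - (1 / (real m + 1)) = - 1"
    by (simp add: field_simps)
  also have "1 - 1 / (real m + 1) = real m / real (Suc m)"
    by (simp add: field_simps)
  finally have e: "real m ^ Suc m * exp 1 \<le> real (Suc m) ^ Suc m"
    by (simp add: power_divide exp_minus field_simps del: power_Suc)
  have "fact m = real m * fact (m - 1)"
    using m by (subst fact_reduce) auto
  then have "fact (Suc m - 1) * exp 1 ^ Suc m = real m * exp 1 * (fact (m - 1) * exp 1 ^ m)"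
    by simp
  also have "\<dots> \<le> real m * exp 1 * real m ^ m"
    using step.IH by (intro mult_left_mono) auto
  also have "\<dots> \<le> real (Suc m) ^ Suc m"
    using e by (simp add: mult_ac)
  finally show ?case .
qed

text \<open>The quantity L. Its exponential is k log k, for k \<ge> 12 at least k L / 2, so the w-th
  power of k L / 2 is at most exp (k L / 2).\<close>

definition log_size :: "nat \<Rightarrow> real" where
  "log_size k = ln (real k) + ln (ln (real k))"

lemma log_size_bounds:
  assumes "k \<ge> 12"
  shows "10/3 \<le> log_size k" "exp (log_size k) = real k * ln (real k)" "log_size k \<le> 2 * ln (real k)"
proof -
  have "exp (12/5 :: real) = exp 1 ^ 2 * exp (2/5)"
    by (simp only: exp_add [symmetric] exp_of_nat_mult [symmetric]) simp
  also have "\<dots> \<le> (27183 / 10000) ^ 2 * (1 / (1 - 2/5 / real 2)) ^ 2"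
    by (intro mult_mono power_mono exp_1_le exp_le_inverse_power) auto
  also have "\<dots> \<le> 12"
    by (simp add: power_divide)
  also have "\<dots> \<le> real k"
    using assms by simp
  finally have l: "12/5 \<le> ln (real k)"
    using assms by (subst ln_ge_iff) auto
  then show 1: "exp (log_size k) = real k * ln (real k)"
    using assms by (simp add: log_size_def exp_add)
  have "exp (10/3 :: real) = exp 1 ^ 3 * exp (1/3)"
    by (simp only: exp_add [symmetric] exp_of_nat_mult [symmetric]) simp
  also have "\<dots> \<le> (27183 / 10000) ^ 3 * (1 / (1 - 1/3 / real 4)) ^ 4"
    by (intro mult_mono power_mono exp_1_le exp_le_inverse_power) auto
  also have "\<dots> \<le> 12 * (12/5)"
    by (simp add: power_divide)
  also have "\<dots> \<le> real k * ln (real k)"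
    using l assms by (intro mult_mono) auto
  finally show "10/3 \<le> log_size k"
    by (simp only: 1 [symmetric] exp_le_cancel_iff)
  have "ln (ln (real k)) \<le> ln (real k) - 1"
    using l by (intro ln_le_minus_one) simp
  then show "log_size k \<le> 2 * ln (real k)"
    by (simp add: log_size_def)
qed

lemma power_gt_quadratic:
  assumes "w \<ge> 6"
  shows "(20 :: real) * real w ^ 2 < (11/2) ^ (w - 2)"
  using assms
proof (induction w rule: dec_induct)
  case base
  show ?case
    by (simp add: power_divide)
next
  case (step w)
  have w6: "6 \<le> real w"
    using step.hyps by simp
  then have "6 * real w \<le> (real w)\<^sup>2"
    unfolding power2_eq_square by (intro mult_right_mono) auto
  moreover have "real (Suc w) ^ 2 = (real w)\<^sup>2 + 2 * real w + 1"
    by (simp add: power2_eq_square algebra_simps)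
  ultimately have "20 * real (Suc w) ^ 2 \<le> 11/2 * (20 * real w ^ 2)"
    using w6 by linarith
  also have "\<dots> < 11/2 * (11/2) ^ (w - 2)"
    using step.IH by simp
  also have "\<dots> = (11/2) ^ (Suc w - 2)"
    using step.hyps by (simp add: Suc_diff_le flip: power_Suc)
  finally show ?case .
qed

text \<open>The threshold exceeds the base on the left by a factor of at least 100 u / 727, which is
  at least 11/2. The number 727 is fitted to u = 40, where both comparisons are nearly equalities.
  Two of these factors match the u^2 in the threshold, and the other w - 2 outgrow w^2.\<close>

lemma threshold_inequality:
  fixes u x :: real
  assumes w: "w \<ge> 6" and u: "u \<ge> 40" and x: "x \<ge> (2 * real w)\<^sup>2 * u\<^sup>2 / 7316"
  shows "672 * ((u / 4 + 25/16) * (2 * real w)\<^sup>2 / 291) ^ w < x ^ (w - 1)"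
proof -
  define q where "q = (u / 4 + 25/16) * (2 * real w)\<^sup>2 / 291"
  define n0 where "n0 = (2 * real w)\<^sup>2 * u\<^sup>2 / 7316"
  have pos: "q > 0" "n0 > 0"
    using u w by (auto simp: q_def n0_def)
  have "(u / 4 + 25/16) / 291 * (100 * u / 727) \<le> u\<^sup>2 / 7316"
    using u by (simp add: field_simps power2_eq_square)
  then have "(2 * real w)\<^sup>2 * ((u / 4 + 25/16) / 291 * (100 * u / 727)) \<le> (2 * real w)\<^sup>2 * (u\<^sup>2 / 7316)"
    by (intro mult_left_mono) auto
  then have "q * (100 * u / 727) \<le> n0"
    by (simp add: q_def n0_def mult_ac)
  then have "(q * (100 * u / 727)) ^ w \<le> n0 ^ w"
    using pos u by (intro power_mono) auto
  then have 1: "q ^ w * (100 * u / 727) ^ w \<le> n0 ^ w"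
    by (simp only: power_mult_distrib)
  have "672 * n0 < (100 * u / 727)\<^sup>2 * (20 * real w ^ 2)"
    using u w by (simp add: n0_def power_mult_distrib power_divide field_simps)
  also have "\<dots> < (100 * u / 727)\<^sup>2 * (11/2) ^ (w - 2)"
    using power_gt_quadratic[OF w] u by (intro mult_strict_left_mono) auto
  also have "\<dots> \<le> (100 * u / 727)\<^sup>2 * (100 * u / 727) ^ (w - 2)"
    using u by (intro mult_left_mono power_mono) auto
  also have "\<dots> = (100 * u / 727) ^ w"
    unfolding power_add [symmetric] using w by (simp only: le_add_diff_inverse)
  finally have "q ^ w * (672 * n0) < q ^ w * (100 * u / 727) ^ w"
    using pos by (intro mult_strict_left_mono) auto
  also note 1
  also have "n0 ^ w = n0 ^ (w - 1) * n0"
    using w by (simp flip: power_Suc2)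
  finally have "672 * q ^ w < n0 ^ (w - 1)"
    using pos by (simp add: mult_ac)
  also have "\<dots> \<le> x ^ (w - 1)"
    using x pos by (intro power_mono) (auto simp: n0_def)
  finally show ?thesis
    by (simp add: q_def)
qed

section \<open>Numerical conditions in weight at least 12\<close>

context
  fixes k w :: nat and L u :: real
  assumes k: "k \<ge> 12" "k = 2 * w"
  defines "L \<equiv> log_size k" and "u \<equiv> real k * L"
begin

lemma size_ge: "u \<ge> 40" "L \<ge> 10/3"
proof -
  show L: "L \<ge> 10/3"
    unfolding L_def by (rule log_size_bounds[OF k(1)])
  have "12 * (10/3) \<le> real k * L"
    using k L by (intro mult_mono) auto
  then show "u \<ge> 40"
    by (simp add: u_def)
qed

lemma half_size_le_exp: "u / 2 \<le> exp L"
  unfolding u_def L_def log_size_bounds(2)[OF k(1)]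
  using mult_left_mono[OF log_size_bounds(3)[OF k(1)], of "real k"] by simp

lemma ex_height_parameter:
  obtains N :: nat where "N \<ge> 3" "real N ^ 2 \<le> u / 4" "u \<le> 4 * (real N + 1)\<^sup>2"
proof -
  \<comment> \<open>The largest N with N^2 \<le> u / 4; u \<ge> 40 gives sqrt u \<ge> 6, hence N
    \<ge> 3.\<close>
  define N where "N = nat \<lfloor>sqrt u / 2\<rfloor>"
  have s: "6 \<le> sqrt u"
    using size_ge by (intro real_le_rsqrt) simp
  have N: "real N \<le> sqrt u / 2" "sqrt u / 2 \<le> real N + 1" "N \<ge> 3"
    unfolding N_def using s by linarith+
  have "real N ^ 2 \<le> (sqrt u / 2)\<^sup>2"
    using N by (intro power_mono) auto
  moreover have "(sqrt u / 2)\<^sup>2 \<le> (real N + 1)\<^sup>2"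
    using N size_ge(1) by (intro power_mono) auto
  moreover have "(sqrt u / 2)\<^sup>2 = u / 4"
    using size_ge(1) by (simp add: power_divide)
  ultimately show ?thesis
    using N(3) by (intro that[of N]) simp_all
qed

text \<open>The power is at most exp (w L) = exp (u / 2). For N \<ge> 3 the next square is at most
  16/9 of N^2, so u / 2 \<le> 24/5 N^2, and 24/5 = 6 * 4/5 is covered by 2 pi > 6. The leftover 6 *
  9/20 = 27/10, from 9/20 = 5/4 - 4/5, yields the 1/8.\<close>

lemma height_condition:
  assumes N: "N \<ge> 3" "real N ^ 2 \<le> u / 4" "u \<le> 4 * (real N + 1)\<^sup>2"
  shows "(real N ^ 2 + 25/16) ^ w * qmod (real N ^ 2 * (4/5) + 5/4 - 4/5) \<le> 1/8"
proof -
  have "real N ^ 2 + 25/16 \<le> u / 2"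
    using N size_ge by simp
  also have "\<dots> \<le> exp L"
    by (rule half_size_le_exp)
  finally have "(real N ^ 2 + 25/16) ^ w \<le> exp L ^ w"
    by (intro power_mono) auto
  also have "\<dots> = exp (u / 2)"
    by (simp add: exp_of_nat_mult [symmetric] u_def k)
  also have "u / 2 \<le> 24/5 * real N ^ 2"
  proof -
    have "3 * (real N + 1) \<le> 4 * real N"
      using N(1) by simp
    then have "(3 * (real N + 1))\<^sup>2 \<le> (4 * real N)\<^sup>2"
      by (intro power_mono) auto
    then have "(real N + 1)\<^sup>2 \<le> 16/9 * real N ^ 2"
      unfolding power_mult_distrib by simp
    then show ?thesis
      using N(3) zero_le_power2[of "real N"] by linarith
  qed
  then have "exp (u / 2) \<le> exp (24/5 * real N ^ 2)"
    by simp
  finally have 1: "(real N ^ 2 + 25/16) ^ w \<le> exp (24/5 * real N ^ 2)" .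
  have "6 * (real N ^ 2 * (4/5) + 9/20) \<le> 2 * pi * (real N ^ 2 * (4/5) + 9/20)"
    using pi_gt3 by (intro mult_right_mono) auto
  moreover have "9 \<le> real N ^ 2"
    using power_mono[of 3 "real N" 2] N(1) by simp
  ultimately have "qmod (real N ^ 2 * (4/5) + 9/20) \<le> exp (- (24/5 * real N ^ 2 + 27/10))"
    by (simp add: qmod_def)
  then have 2: "qmod (real N ^ 2 * (4/5) + 5/4 - 4/5) \<le> exp (- (24/5 * real N ^ 2 + 27/10))"
  proof -
    have "real N ^ 2 * (4/5) + 5/4 - 4/5 = real N ^ 2 * (4/5) + 9/20"
      by simp
    with \<open>qmod _ \<le> _\<close> show ?thesis
      by (simp only:)
  qed
  have "(real N ^ 2 + 25/16) ^ w * qmod (real N ^ 2 * (4/5) + 5/4 - 4/5)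
      \<le> exp (24/5 * real N ^ 2) * exp (- (24/5 * real N ^ 2 + 27/10))"
    by (intro mult_mono 1 2) auto
  also have "\<dots> = exp (- (27/10))"
    by (simp flip: exp_add)
  also have "\<dots> \<le> 1/8"
  proof -
    have "8 \<le> (27182 / 10000 :: real)\<^sup>2 * (17/10)"
      by (simp add: power2_eq_square)
    also have "\<dots> \<le> exp 1 ^ 2 * exp (7/10)"
      using exp_ge_add_one_self[of "7/10"] exp_1_ge by (intro mult_mono power_mono) auto
    also have "\<dots> = exp (27/10)"
      by (simp only: exp_add [symmetric] exp_of_nat_mult [symmetric]) simp
    finally show ?thesis
      by (simp add: exp_minus field_simps)
  qed
  finally show ?thesis .
qed

text \<open>The logarithm of n^(w+4) is at most 4 n / u, while the decay exponent is 2 pi n / Y with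
  Y \<le> u / 4.\<close>

lemma tail_condition:
  assumes N: "real N ^ 2 \<le> u / 4" and n: "real n > u\<^sup>2"
  shows "real n ^ (w + 4) * qmod (1 / (real N ^ 2 * (4/5) + 5/4)) ^ n \<le> 1"
proof -
  define Y where "Y = real N ^ 2 * (4/5) + 5/4"
  have Y: "Y > 0" "Y \<le> u / 4"
    using N size_ge by (simp_all add: Y_def add_nonneg_pos)
  have u: "u > 0"
    using size_ge by simp
  \<comment> \<open>Measures how far n lies beyond u^2: n = (u r)^2 with r > 1, which turns n^(w+4)
    into (u r)^(k+8).\<close>
  define r where "r = sqrt (real n) / u"
  have r: "r > 1" and n_eq: "real n = (u * r)\<^sup>2"
    using n u by (simp_all add: r_def real_less_rsqrt)
  have "u * r \<le> exp (L + 1 + r)"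
  proof -
    have "u \<le> 2 * exp L"
      using half_size_le_exp by simp
    also have "\<dots> \<le> exp 1 * exp L"
      using exp_1_ge by (intro mult_right_mono) auto
    finally have "u * r \<le> (exp 1 * exp L) * exp r"
      using r u order_trans[OF _ exp_ge_add_one_self[of r], of r] by (intro mult_mono) auto
    then show ?thesis
      by (simp add: exp_add mult_ac)
  qed
  then have "(u * r) ^ (k + 8) \<le> exp (L + 1 + r) ^ (k + 8)"
    using u r by (intro power_mono) auto
  also have "\<dots> = exp (real (k + 8) * (L + 1 + r))"
    by (rule exp_of_nat_mult [symmetric])
  also have "\<dots> \<le> exp (2 * real k * (2 * L * r\<^sup>2))"
  proof -
    have "L * 1 \<le> L * r" "r * 1 \<le> r * r"
      using size_ge r by (intro mult_left_mono; simp)+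
    moreover have "10/3 * r \<le> L * r"
      using size_ge r by (intro mult_right_mono) auto
    ultimately have "L + 1 + r \<le> 2 * L * r"
      using r by linarith
    also have "\<dots> \<le> 2 * L * r\<^sup>2"
      using \<open>r * 1 \<le> r * r\<close> size_ge by (intro mult_left_mono) (auto simp: power2_eq_square)
    finally have "real (k + 8) * (L + 1 + r) \<le> 2 * real k * (2 * L * r\<^sup>2)"
      using k(1) size_ge r by (intro mult_mono) auto
    then show ?thesis
      by simp
  qed
  also have "2 * real k * (2 * L * r\<^sup>2) = 4 * u * r\<^sup>2"
    by (simp add: u_def)
  finally have 1: "(u * r) ^ (k + 8) \<le> exp (4 * u * r\<^sup>2)" .
  have "4 * u * r\<^sup>2 \<le> 2 * pi * real n * (1 / Y)"
  proof -
    have "4 * u * r\<^sup>2 = 4 * real n * (1 / u)"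
      using u by (simp add: n_eq power2_eq_square)
    also have "\<dots> \<le> 2 * pi * real n * (1 / Y)"
      using Y u pi_gt3 by (intro mult_mono divide_left_mono) auto
    finally show ?thesis .
  qed
  then have 2: "qmod (1 / Y) ^ n \<le> exp (- (4 * u * r\<^sup>2))"
    unfolding qmod_power by simp
  have "real n ^ (w + 4) = (u * r) ^ (k + 8)"
    by (simp add: n_eq k(2) flip: power_mult)
  then have "real n ^ (w + 4) * qmod (1 / Y) ^ n \<le> exp (4 * u * r\<^sup>2) * exp (- (4 * u * r\<^sup>2))"
    using 1 2 by (intro mult_mono) auto
  also have "\<dots> = 1"
    by (simp flip: exp_add)
  finally show ?thesis
    by (simp only: Y_def)
qed

text \<open>Cancelling x^w leaves x^(w-1). Stirling replaces the factorial by (k / e)^k, and (2 pi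
  e)^2 \<ge> 291 supplies the base of the threshold inequality.\<close>

lemma Eisenstein_dominates:
  fixes x :: real
  assumes N: "real N ^ 2 \<le> u / 4" and x: "x \<ge> (real k)\<^sup>2 * u\<^sup>2 / 7316"
  shows "8/3 * (real N ^ 2 + 25/16) ^ w / qmod (4/5) * x ^ w
    < 6 / pi\<^sup>2 * (2 * pi) ^ (2 * w) / fact (2 * w - 1) * x ^ (2 * w - 1)"
proof -
  have w: "w \<ge> 6"
    using k by simp
  have "0 < (real k)\<^sup>2 * u\<^sup>2 / 7316"
    using k size_ge by simp
  with x have x0: "x > 0"
    by linarith
  define F where "F = (fact (2 * w - 1) :: real)"
  define G where "G = exp 1 ^ (2 * w) * (2 * pi) ^ (2 * w)"
  have F: "F > 0" and FG: "F * exp 1 ^ (2 * w) \<le> real k ^ (2 * w)"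
    using fact_exp_le[OF k(1)] by (simp_all add: F_def k(2))
  have pi2: "pi\<^sup>2 / 6 \<le> 1.6451"
  proof -
    have "pi * pi \<le> 3.1416 * 3.1416"
      using pi_approx by (intro mult_mono) auto
    then show ?thesis
      by (simp add: power2_eq_square)
  qed
  have G: "291 ^ w \<le> G"
  proof -
    have "291 \<le> (27182 / 10000 * (2 * 3.1415) :: real)\<^sup>2"
      by (simp add: power2_eq_square)
    also have "\<dots> \<le> (exp 1 * (2 * pi))\<^sup>2"
      using exp_1_ge pi_approx by (intro power_mono mult_mono) auto
    finally have "291 ^ w \<le> ((exp 1 * (2 * pi))\<^sup>2) ^ w"
      by (intro power_mono) auto
    then show ?thesis
      by (simp only: G_def power_mult [symmetric] power_mult_distrib)
  qed
  have "0 \<le> (u / 4 + 25/16) ^ w"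
    using size_ge(1) by (intro zero_le_power) simp
  \<comment> \<open>The constants multiply to 8/3 * 153 * 1.6451, which is below 672.\<close>
  have "8/3 * (real N ^ 2 + 25/16) ^ w * (1 / qmod (4/5)) * (pi\<^sup>2 / 6) * (F * exp 1 ^ (2 * w))
      \<le> 8/3 * (u / 4 + 25/16) ^ w * 153 * 1.6451 * real k ^ (2 * w)"
    using N F \<open>0 \<le> (u / 4 + 25/16) ^ w\<close> by (intro mult_mono power_mono inverse_qmod_le pi2 FG mult_nonneg_nonneg add_mono) auto
  also have "\<dots> \<le> 672 * ((u / 4 + 25/16) * (2 * real w)\<^sup>2) ^ w"
    using size_ge by (simp add: k(2) power_mult_distrib power_mult)
  also have "\<dots> = 291 ^ w * (672 * ((u / 4 + 25/16) * (2 * real w)\<^sup>2 / 291) ^ w)"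
    by (simp add: power_divide)
  also have "\<dots> < 291 ^ w * x ^ (w - 1)"
    using threshold_inequality[OF w size_ge(1), of x] x by (intro mult_strict_left_mono) (auto simp: k(2))
  also have "\<dots> \<le> G * x ^ (w - 1)"
    using G x0 by (intro mult_right_mono) auto
  finally have "8/3 * (real N ^ 2 + 25/16) ^ w * (1 / qmod (4/5)) * (pi\<^sup>2 / 6) * (F * exp 1 ^ (2 * w))
      < (2 * pi) ^ (2 * w) * x ^ (w - 1) * exp 1 ^ (2 * w)"
    by (simp add: G_def mult_ac)
  then have "(8/3 * (real N ^ 2 + 25/16) ^ w * (1 / qmod (4/5)) * (pi\<^sup>2 / 6) * F) * exp 1 ^ (2 * w)
      < ((2 * pi) ^ (2 * w) * x ^ (w - 1)) * exp 1 ^ (2 * w)"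
    by (simp only: mult.assoc)
  then have "8/3 * (real N ^ 2 + 25/16) ^ w * (1 / qmod (4/5)) * (pi\<^sup>2 / 6) * F < (2 * pi) ^ (2 * w) * x ^ (w - 1)"
    by (subst (asm) mult_less_cancel_right_pos) auto
  then have "8/3 * (real N ^ 2 + 25/16) ^ w / qmod (4/5) < 6 / pi\<^sup>2 * (2 * pi) ^ (2 * w) / F * x ^ (w - 1)"
    using F by (simp add: field_simps)
  then have "8/3 * (real N ^ 2 + 25/16) ^ w / qmod (4/5) * x ^ w
      < 6 / pi\<^sup>2 * (2 * pi) ^ (2 * w) / F * x ^ (w - 1) * x ^ w"
    using x0 by (intro mult_strict_right_mono) auto
  also have "\<dots> = 6 / pi\<^sup>2 * (2 * pi) ^ (2 * w) / F * x ^ (2 * w - 1)"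
  proof -
    have "2 * w - 1 = (w - 1) + w"
      using w by simp
    then show ?thesis
      by (simp add: power_add)
  qed
  finally show ?thesis
    by (simp only: F_def)
qed

end

theorem theorem3:
  fixes k :: nat and f :: "complex \<Rightarrow> complex" and a :: "nat \<Rightarrow> complex"
  assumes "k > 0" and "k mod 4 = 0"
    and "modular_form k f"
    and "fourier_coeffs f a"
    and "a 0 = 1"
    and "\<forall>n::nat. 1 \<le> n \<and> real n \<le> (real k)^2 * (ln (real k) + ln (ln (real k)))^2
            \<longrightarrow> a n \<in> \<real> \<and> Re (a n) \<ge> 0"
  shows "\<forall>n::nat. real n \<ge> (real k)^4 * (ln (real k) + ln (ln (real k)))^2 / 7316
            \<longrightarrow> a n \<in> \<real> \<and> Re (a n) > 0"
proof (intro allI impI)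
  fix n :: nat
  assume "(real k)^4 * (ln (real k) + ln (ln (real k)))^2 / 7316 \<le> real n"
  then have n_ge: "(real k)\<^sup>2 * (real k * log_size k)\<^sup>2 / 7316 \<le> real n"
    by (simp add: log_size_def power_mult_distrib power2_eq_square power4_eq_xxxx mult_ac)
  obtain j where "k = 4 * j"
    using assms(2) by (metis dvdE mod_0_imp_dvd)
  define w where "w = 2 * j"
  have w: "k = 2 * w" "even w" "w \<ge> 2"
    using assms(1) \<open>k = 4 * j\<close> by (auto simp: w_def)
  have mf: "weakly_modular (2 * w) f"
    using modular_form_imp_weakly_modular[OF assms(3)] w by simp
  obtain E and e :: "nat \<Rightarrow> real" where E: "fourier_coeffs E (\<lambda>n. of_real (e n))" "weakly_modular (2 * w) E" "e 0 = 1"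
    and e: "\<And>n. n > 0 \<Longrightarrow> 6 / pi\<^sup>2 * (2 * pi) ^ (2 * w) / fact (2 * w - 1) * real n ^ (2 * w - 1) \<le> e n"
    using Eisenstein_series[OF w(2,3)] by blast
  have e_pos: "e n > 0" if "n > 0" for n
    by (rule less_le_trans[OF _ e[OF that]]) (use that in simp)
  show "a n \<in> \<real> \<and> Re (a n) > 0"
  proof (cases "w \<le> 4")
    case True
    \<comment> \<open>Both constant terms are 1, so f - E vanishes at the cusp, and w \<le> 4 is the
      vanishing criterion with m = 1.\<close>
    have "a n - of_real (e n) = 0" for n
      by (rule modular_form_vanishing[OF fourier_coeffs_diff[OF assms(4) E(1)]
            weakly_modular_diff[OF mf E(2)], of 1]) (use assms(5) E(3) w True in auto)
    then have a_eq: "a n = of_real (e n)"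
      by simp
    have k4: "real k \<ge> 4"
      using w by simp
    then have "exp 1 < real k"
      using exp_1_le by linarith
    then have "ln (exp 1) < ln (real k)"
      using k4 by (subst ln_less_cancel_iff) auto
    then have "log_size k > 0"
      by (simp add: log_size_def add_pos_pos)
    then have "0 < (real k)\<^sup>2 * (real k * log_size k)\<^sup>2 / 7316"
      using k4 by simp
    with n_ge have "n > 0"
      by (cases "n = 0") auto
    then show ?thesis
      using e_pos by (simp add: a_eq)
  next
    case False
    then have k: "k \<ge> 12"
      using w by presburger
    define u where "u = real k * log_size k"
    have u: "u \<ge> 40"
      unfolding u_def by (rule size_ge(1)[OF k w(1)])
    have nonneg: "a n \<in> \<real>" "Re (a n) \<ge> 0" if "n > 0" "real n \<le> u\<^sup>2" for n
      using assms(6) that by (auto simp: u_def log_size_def power_mult_distrib Suc_le_eq)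
    \<comment> \<open>Since k \<le> u \<le> u^2, all coefficients of index below k are real by
      assumption; the difference from the conjugate form thus vanishes to order k, which exceeds w /
      4.\<close>
    have "a n - cnj (a n) = 0" for n
    proof (rule modular_form_vanishing[OF fourier_coeffs_diff[OF assms(4) fourier_coeffs_cnj[OF assms(4)]]
            weakly_modular_diff[OF mf weakly_modular_cnj[OF mf]], of k])
      fix n assume "n < k"
      show "a n - cnj (a n) = 0"
      proof (cases "n = 0")
        case False
        have "real n \<le> real k * 1"
          using \<open>n < k\<close> by simp
        also have "\<dots> \<le> u"
          unfolding u_def using size_ge(2)[OF k w(1)] by (intro mult_left_mono) auto
        finally have "real n * 1 \<le> u * u"
          using u by (intro mult_mono) auto
        then have "a n \<in> \<real>"
          using False by (intro nonneg) (auto simp: power2_eq_square)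
        then show ?thesis
          by (simp add: Reals_cnj_iff)
      qed (use assms(5) in simp)
    qed (use w in auto)
    then have a_eq: "a n = of_real (Re (a n))" for n
      by (metis Reals_cnj_iff eq_iff_diff_eq_0 of_real_Re)
    obtain N :: nat where N: "N \<ge> 3" "real N ^ 2 \<le> u / 4" "u \<le> 4 * (real N + 1)\<^sup>2"
      using ex_height_parameter[OF k w(1)] unfolding u_def by blast
    have "0 < (real k)\<^sup>2 * u\<^sup>2 / 7316"
      using k u by simp
    then have n0: "n > 0"
      using n_ge by (cases "n = 0") (auto simp: u_def)
    have "\<bar>Re (a n) - e n\<bar> \<le> 8/3 * (real N ^ 2 + 25/16) ^ w / qmod (4/5) * real n ^ w"
    proof (rule coeff_le_of_initial_nonneg[where X = "u\<^sup>2" and f = f and E = E])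
      show "fourier_coeffs f (\<lambda>n. of_real (Re (a n)))"
        using assms(4) by (simp flip: a_eq)
      show "e n \<ge> 0" for n
        using e_pos[of n] E(3) by (cases "n = 0") auto
      show "u\<^sup>2 \<ge> 100"
        using power_mono[OF u, of 2] by simp
      show "(real N ^ 2 + 25/16) ^ w * qmod (real N ^ 2 * (4/5) + 5/4 - 4/5) \<le> 1/8"
        using height_condition[OF k w(1)] N unfolding u_def by blast
      show "real n ^ (w + 4) * qmod (1 / (real N ^ 2 * (4/5) + 5/4)) ^ n \<le> 1" if "real n > u\<^sup>2" for n
        using tail_condition[OF k w(1)] N that unfolding u_def by blast
    qed (use mf E nonneg n0 w N assms(5) in auto)
    also have "\<dots> < 6 / pi\<^sup>2 * (2 * pi) ^ (2 * w) / fact (2 * w - 1) * real n ^ (2 * w - 1)"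
      using Eisenstein_dominates[OF k w(1)] N n_ge unfolding u_def by blast
    also have "\<dots> \<le> e n"
      by (rule e[OF n0])
    finally have "Re (a n) > 0"
      by linarith
    then show ?thesis
      using a_eq[of n] by (metis Reals_of_real)
  qed
qed

end
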